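(* Let $k$ be a field, $m\ge1$, and let $K_m=\{\sigma\subseteq[m] : \#\sigma\le m-2\}$. Each torsion object $M\in\mathcal{T}$ of $\mathcal{L}(K_m)$ decomposes as a direct sum of objects of the form $[a,b)_i$ with $i\in[m]$ and $a<b$ in $\mathbb{N}$.
   Context: $R=k[t_1,\dots,t_m]$ is $\mathbb{N}^m$-graded ($0\in\mathbb{N}$) with $|t_i|=\vec e_i$. All modules are multigraded and morphisms preserve multidegree. For $\sigma\subseteq[m]=\{1,\dots,m\}$, let $\sigma^{-1}\mathbb{N}^m=\{\vec d\in\mathbb{Z}^m : d_i\ge 0 \text{ for } i\notin\sigma\}$ and $R_\sigma=R[t_i^{-1}\mid i\in\sigma]$; $R_\sigma$-modules are $\sigma^{-1}\mathbb{N}^m$-graded (extended by zero to larger grading sets when necessary). Write $\sigma_i=[m]\setminus\{i\}$. The subsets of $[m]$ not in $K_m$ are $[m],\sigma_1,\dots,\sigma_m$. An object $M$ of $\mathcal{L}(K_m)$ consists of finitely generated $R_{\sigma_i}$-modules $M_{\sigma_i}$ ($1\le i\le m$), a finitely generated $R_{[m]}$-module $M_{[m]}$, and $R_{\sigma_i}$-module maps $\varphi_i\colon M_{\sigma_i}\to M_{[m]}$ whose induced maps $R_{[m]}\otimes_{R_{\sigma_i}}M_{\sigma_i}\to M_{[m]}$ are isomorphisms. Morphisms are families of module maps commuting with the $\varphi_i$; $\mathcal{L}(K_m)$ is abelian with kernels and cokernels computed pointwise. $\mathcal{T}$ is the full subcategory of objects $M$ such that, for all $i$, every element of $M_{\sigma_i}$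 is annihilated by a power of $t_i$; equivalently $M_{[m]}=0$. For $a<b$ in $\mathbb{N}$ and $i\in[m]$, $[a,b)_i$ is the object of $\mathcal{L}(K_m)$ with value $t_i^aR_{\sigma_i}/t_i^bR_{\sigma_i}$ at $\sigma_i$ and value $0$ at $\sigma_j$ for $j\ne i$ and at $[m]$. *)

theory Defs
  imports
    "HOL-Analysis.Finite_Cartesian_Product"
    "HOL-Algebra.Module"
    "HOL-Algebra.AbelCoset"
    "HOL-Algebra.Generated_Groups"
    "HOL-Algebra.Free_Abelian_Groups"
begin

text \<open>
  The index set \<open>[m]\<close> is \<open>UNIV :: 'm set\<close> for a finite (hence nonempty) type \<open>'m\<close>, and
  \<open>\<int>\<^sup>m\<close> is \<^typ>\<open>int ^ 'm\<close>.  Laurent polynomials over \<open>k\<close> are finitely supported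
  functions from exponents to coefficients, with the convolution product of
  \<^theory>\<open>HOL-Library.Poly_Mapping\<close>.
\<close>

type_synonym ('k, 'm) laurent = "(int ^ 'm) \<Rightarrow>\<^sub>0 'k"

definition monom :: "'m \<Rightarrow> nat \<Rightarrow> ('k::field, 'm::finite) laurent" where
  "monom i n = Poly_Mapping.single (axis i (int n)) 1"

definition degrees :: "'m set \<Rightarrow> (int ^ 'm) set" where
  "degrees \<sigma> = {d. \<forall>i. i \<notin> \<sigma> \<longrightarrow> 0 \<le> d $ i}"

text \<open>
  The homogeneous parts \<open>grd M d\<close> are indexed by all of \<open>\<int>\<^sup>m\<close> (extension by zero).
  The fields \<open>mult\<close> and \<open>one\<close> inherited from rings are irrelevant for modules.
\<close>

record ('r, 'a, 'd) gmodule = "('r, 'a) module" +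
  grd :: "'d \<Rightarrow> 'a set"

text \<open>
  \<open>R\<^sub>\<sigma> = k[t\<^sub>1,\<dots>,t\<^sub>m][t\<^sub>i\<^sup>-\<^sup>1 | i \<in> \<sigma>]\<close>, realised inside the Laurent polynomial ring (see
  \<open>Loc_eq_fractions\<close> below), both as a graded ring and as a graded module over itself.
\<close>

definition Loc ::
  "'m set \<Rightarrow> (('k, 'm) laurent, ('k::field, 'm::finite) laurent, int ^ 'm) gmodule" where
  "Loc \<sigma> = \<lparr>carrier = {p. Poly_Mapping.keys p \<subseteq> degrees \<sigma>}, monoid.mult = (*), monoid.one = 1,
      ring.zero = 0, ring.add = (+), smult = (*),
      grd = (\<lambda>d. {p. Poly_Mapping.keys p \<subseteq> degrees \<sigma> \<inter> {d}})\<rparr>"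

definition graded_module ::
  "'m set \<Rightarrow> (('k::field, 'm::finite) laurent, 'a, int ^ 'm) gmodule \<Rightarrow> bool" where
  "graded_module \<sigma> M \<longleftrightarrow>
     module (Loc \<sigma>) M \<and>
     (\<forall>d. additive_subgroup (grd M d) M) \<and>
     (\<forall>d. d \<notin> degrees \<sigma> \<longrightarrow> grd M d = {\<zero>\<^bsub>M\<^esub>}) \<and>
     (\<forall>d e. \<forall>r\<in>grd (Loc \<sigma>) d. \<forall>x\<in>grd M e. r \<odot>\<^bsub>M\<^esub> x \<in> grd M (d + e)) \<and>
     (\<forall>x\<in>carrier M. \<exists>!c. (\<forall>d. c d \<in> grd M d) \<and> finite {d. c d \<noteq> \<zero>\<^bsub>M\<^esub>} \<and>
        x = (\<Oplus>\<^bsub>M\<^esub>d\<in>{d. c d \<noteq> \<zero>\<^bsub>M\<^esub>}. c d))"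

definition finitely_generated :: "('r, 'b) ring_scheme \<Rightarrow> ('r, 'a, 'd) gmodule \<Rightarrow> bool" where
  "finitely_generated R M \<longleftrightarrow> (\<exists>A. finite A \<and> A \<subseteq> carrier M \<and>
     (\<forall>x\<in>carrier M. \<exists>c\<in>A \<rightarrow> carrier R. x = (\<Oplus>\<^bsub>M\<^esub>a\<in>A. c a \<odot>\<^bsub>M\<^esub> a)))"

definition gmod_hom ::
  "('r, 'c) ring_scheme \<Rightarrow> ('r, 'a, 'd) gmodule \<Rightarrow> ('r, 'b, 'd) gmodule \<Rightarrow> ('a \<Rightarrow> 'b) set" where
  "gmod_hom R M N = {f \<in> carrier M \<rightarrow> carrier N.
     (\<forall>x\<in>carrier M. \<forall>y\<in>carrier M. f (x \<oplus>\<^bsub>M\<^esub> y) = f x \<oplus>\<^bsub>N\<^esub> f y) \<and>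
     (\<forall>r\<in>carrier R. \<forall>x\<in>carrier M. f (r \<odot>\<^bsub>M\<^esub> x) = r \<odot>\<^bsub>N\<^esub> f x) \<and>
     (\<forall>d. f ` grd M d \<subseteq> grd N d)}"

definition gmod_iso ::
  "('r, 'c) ring_scheme \<Rightarrow> ('r, 'a, 'd) gmodule \<Rightarrow> ('r, 'b, 'd) gmodule \<Rightarrow> ('a \<Rightarrow> 'b) set" where
  "gmod_iso R M N = {f \<in> gmod_hom R M N. \<exists>g\<in>gmod_hom R N M.
     (\<forall>x\<in>carrier M. g (f x) = x) \<and> (\<forall>y\<in>carrier N. f (g y) = y)}"

text \<open>\<open>gmod_quot M N\<close> is the quotient of \<open>M\<close> by the submodule with carrier \<open>N\<close>.\<close>

definition gmod_quot :: "('r, 'a, 'd) gmodule \<Rightarrow> 'a set \<Rightarrow> ('r, 'a set, 'd) gmodule" where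
  "gmod_quot M N = \<lparr>carrier = a_rcosets\<^bsub>M\<^esub> N, monoid.mult = undefined, monoid.one = undefined,
      ring.zero = N, ring.add = set_add M, smult = (\<lambda>r X. \<Union>x\<in>X. N +>\<^bsub>M\<^esub> (r \<odot>\<^bsub>M\<^esub> x)),
      grd = (\<lambda>d. (\<lambda>x. N +>\<^bsub>M\<^esub> x) ` grd M d)\<rparr>"

definition gmod_sum ::
  "'i set \<Rightarrow> ('i \<Rightarrow> ('r, 'a, 'd) gmodule) \<Rightarrow> ('r, 'i \<Rightarrow> 'a, 'd) gmodule" where
  "gmod_sum I M = \<lparr>
      carrier = {x \<in> \<Pi>\<^sub>E i\<in>I. carrier (M i). finite {i \<in> I. x i \<noteq> \<zero>\<^bsub>M i\<^esub>}},
      monoid.mult = undefined, monoid.one = undefined,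
      ring.zero = (\<lambda>i\<in>I. \<zero>\<^bsub>M i\<^esub>),
      ring.add = (\<lambda>x y. \<lambda>i\<in>I. x i \<oplus>\<^bsub>M i\<^esub> y i),
      smult = (\<lambda>r x. \<lambda>i\<in>I. r \<odot>\<^bsub>M i\<^esub> x i),
      grd = (\<lambda>d. {x \<in> \<Pi>\<^sub>E i\<in>I. grd (M i) d. finite {i \<in> I. x i \<noteq> \<zero>\<^bsub>M i\<^esub>}})\<rparr>"

definition gmod_zero :: "'a \<Rightarrow> ('r, 'a, 'd) gmodule" where
  "gmod_zero z = \<lparr>carrier = {z}, monoid.mult = undefined, monoid.one = undefined,
      ring.zero = z, ring.add = (\<lambda>_ _. z), smult = (\<lambda>_ _. z), grd = (\<lambda>_. {z})\<rparr>"

text \<open>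
  The tensor product \<open>S \<otimes>\<^sub>R M\<close> for a graded ring \<open>S\<close> containing \<open>R\<close>: the free abelian group on
  \<open>S \<times> M\<close> modulo the usual relations, with \<open>S\<close> acting on the left factor.  The record
  \<open>tensor_free\<close> is not an \<open>S\<close>-module yet (the action is not additive in the scalar); its quotient is.
\<close>

definition tensor_free ::
  "('s, 's, 'd::plus) gmodule \<Rightarrow> ('s, 'a, 'd) gmodule \<Rightarrow> ('s, ('s \<times> 'a) \<Rightarrow>\<^sub>0 int, 'd) gmodule" where
  "tensor_free S M = \<lparr>
      carrier = carrier (free_Abelian_group (carrier S \<times> carrier M)),
      monoid.mult = undefined, monoid.one = undefined, ring.zero = 0, ring.add = (+),
      smult = (\<lambda>s. frag_extend (\<lambda>(s', x). frag_of (s \<otimes>\<^bsub>S\<^esub> s', x))),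
      grd = (\<lambda>d. generate (free_Abelian_group (carrier S \<times> carrier M))
        {frag_of (s, x) | s x e e'. s \<in> grd S e \<and> x \<in> grd M e' \<and> e + e' = d})\<rparr>"

definition tensor_relations ::
  "('s, 's, 'd) gmodule \<Rightarrow> ('s, 'c) ring_scheme \<Rightarrow> ('s, 'a, 'd) gmodule \<Rightarrow> (('s \<times> 'a) \<Rightarrow>\<^sub>0 int) set"
where
  "tensor_relations S R M = generate (free_Abelian_group (carrier S \<times> carrier M))
     ({frag_of (s \<oplus>\<^bsub>S\<^esub> s', x) - frag_of (s, x) - frag_of (s', x) | s s' x.
         s \<in> carrier S \<and> s' \<in> carrier S \<and> x \<in> carrier M} \<union>
      {frag_of (s, x \<oplus>\<^bsub>M\<^esub> y) - frag_of (s, x) - frag_of (s, y) | s x y.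
         s \<in> carrier S \<and> x \<in> carrier M \<and> y \<in> carrier M} \<union>
      {frag_of (s \<otimes>\<^bsub>S\<^esub> r, x) - frag_of (s, r \<odot>\<^bsub>M\<^esub> x) | s r x.
         s \<in> carrier S \<and> r \<in> carrier R \<and> x \<in> carrier M})"

definition tensor ::
  "('s, 's, 'd::plus) gmodule \<Rightarrow> ('s, 'c) ring_scheme \<Rightarrow> ('s, 'a, 'd) gmodule \<Rightarrow>
    ('s, (('s \<times> 'a) \<Rightarrow>\<^sub>0 int) set, 'd) gmodule" where
  "tensor S R M = gmod_quot (tensor_free S M) (tensor_relations S R M)"

text \<open>The map \<open>S \<otimes>\<^sub>R M \<rightarrow> N\<close>, \<open>s \<otimes> x \<mapsto> s \<cdot> f x\<close>, evaluated on cosets of formal sums.\<close>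

definition tensor_induced ::
  "('s, 'b, 'd) gmodule \<Rightarrow> ('a \<Rightarrow> 'b) \<Rightarrow> (('s \<times> 'a) \<Rightarrow>\<^sub>0 int) set \<Rightarrow> 'b" where
  "tensor_induced N f X = the_elem ((\<lambda>c. \<Oplus>\<^bsub>N\<^esub>p\<in>Poly_Mapping.keys c.
      [Poly_Mapping.lookup c p] \<cdot>\<^bsub>N\<^esub> (fst p \<odot>\<^bsub>N\<^esub> f (snd p))) ` X)"

text \<open>
  \<open>K\<^sub>m\<close>; the condition \<open>#\<sigma> \<le> m - 2\<close> is written without truncated subtraction, so that
  \<open>K\<^sub>1\<close> is empty.
\<close>

definition K :: "'m::finite set set" where
  "K = {\<sigma>. card \<sigma> + 2 \<le> CARD('m)}"

text \<open>
  \<open>val M \<sigma>\<close> is relevant only for \<open>\<sigma> \<notin> K\<close>, that is, for \<open>\<sigma> = [m]\<close> and \<open>\<sigma> = \<sigma>\<^sub>i = - {i}\<close>;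
  \<open>str M i\<close> is the map \<open>\<phi>\<^sub>i\<close>.
\<close>

record ('r, 'm, 'a) Ldata =
  val :: "'m set \<Rightarrow> ('r, 'a, int ^ 'm) gmodule"
  str :: "'m \<Rightarrow> 'a \<Rightarrow> 'a"

type_synonym ('k, 'm, 'a) Lobj = "(('k, 'm) laurent, 'm, 'a) Ldata"

definition L_object :: "('k::field, 'm::finite, 'a) Lobj \<Rightarrow> bool" where
  "L_object M \<longleftrightarrow>
     (\<forall>\<sigma>. \<sigma> \<notin> K \<longrightarrow> graded_module \<sigma> (val M \<sigma>) \<and> finitely_generated (Loc \<sigma>) (val M \<sigma>)) \<and>
     (\<forall>i. str M i \<in> gmod_hom (Loc (- {i})) (val M (- {i})) (val M UNIV) \<and>
        tensor_induced (val M UNIV) (str M i) \<in>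
          gmod_iso (Loc UNIV) (tensor (Loc UNIV) (Loc (- {i})) (val M (- {i}))) (val M UNIV))"

definition L_hom ::
  "('k::field, 'm::finite, 'a) Lobj \<Rightarrow> ('k, 'm, 'b) Lobj \<Rightarrow> ('m set \<Rightarrow> 'a \<Rightarrow> 'b) set" where
  "L_hom M N = {f. (\<forall>\<sigma>. \<sigma> \<notin> K \<longrightarrow> f \<sigma> \<in> gmod_hom (Loc \<sigma>) (val M \<sigma>) (val N \<sigma>)) \<and>
     (\<forall>i. \<forall>x\<in>carrier (val M (- {i})). f UNIV (str M i x) = str N i (f (- {i}) x))}"

definition L_isomorphic ::
  "('k::field, 'm::finite, 'a) Lobj \<Rightarrow> ('k, 'm, 'b) Lobj \<Rightarrow> bool" where
  "L_isomorphic M N \<longleftrightarrow> (\<exists>f\<in>L_hom M N. \<exists>g\<in>L_hom N M. \<forall>\<sigma>. \<sigma> \<notin> K \<longrightarrow>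
     (\<forall>x\<in>carrier (val M \<sigma>). g \<sigma> (f \<sigma> x) = x) \<and> (\<forall>y\<in>carrier (val N \<sigma>). f \<sigma> (g \<sigma> y) = y))"

definition L_sum ::
  "'i set \<Rightarrow> ('i \<Rightarrow> ('k::field, 'm::finite, 'a) Lobj) \<Rightarrow> ('k, 'm, 'i \<Rightarrow> 'a) Lobj" where
  "L_sum I M = \<lparr>val = (\<lambda>\<sigma>. gmod_sum I (\<lambda>s. val (M s) \<sigma>)),
      str = (\<lambda>i x. \<lambda>s\<in>I. str (M s) i (x s))\<rparr>"

definition torsion_object :: "('k::field, 'm::finite, 'a) Lobj \<Rightarrow> bool" where
  "torsion_object M \<longleftrightarrow> L_object M \<and>
     (\<forall>i. \<forall>x\<in>carrier (val M (- {i})). \<exists>n. monom i n \<odot>\<^bsub>val M (- {i})\<^esub> x = \<zero>\<^bsub>val M (- {i})\<^esub>)"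

text \<open>\<open>t\<^sub>i\<^sup>a R\<^sub>\<sigma>\<close> as a graded submodule of \<open>R\<^sub>\<sigma>\<close>.\<close>

definition monom_ideal ::
  "'m set \<Rightarrow> 'm \<Rightarrow> nat \<Rightarrow> (('k, 'm) laurent, ('k::field, 'm::finite) laurent, int ^ 'm) gmodule" where
  "monom_ideal \<sigma> i a = (Loc \<sigma>)\<lparr>carrier := (\<lambda>p. monom i a * p) ` carrier (Loc \<sigma>),
      grd := (\<lambda>d. grd (Loc \<sigma>) d \<inter> (\<lambda>p. monom i a * p) ` carrier (Loc \<sigma>))\<rparr>"

definition interval ::
  "'m \<Rightarrow> nat \<Rightarrow> nat \<Rightarrow> ('k::field, 'm::finite, ('k, 'm) laurent set) Lobj" where
  "interval i a b = \<lparr>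
      val = (\<lambda>\<sigma>. if \<sigma> = - {i}
        then gmod_quot (monom_ideal \<sigma> i a) (carrier (monom_ideal \<sigma> i b)) else gmod_zero {0}),
      str = (\<lambda>_ _. {0})\<rparr>"

lemma not_in_K_iff: "(\<sigma> :: 'm::finite set) \<notin> K \<longleftrightarrow> \<sigma> = UNIV \<or> (\<exists>i. \<sigma> = - {i})"
proof -
  have "\<sigma> \<notin> K \<longleftrightarrow> card (- \<sigma>) \<le> 1"
    using card_Un_disjoint[of \<sigma> "- \<sigma>"] by (simp add: K_def) linarith
  also have "\<dots> \<longleftrightarrow> \<sigma> = UNIV \<or> (\<exists>i. \<sigma> = - {i})"
  proof
    assume "card (- \<sigma>) \<le> 1"
    then consider "card (- \<sigma>) = 0" | "card (- \<sigma>) = 1" by linarith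
    then show "\<sigma> = UNIV \<or> (\<exists>i. \<sigma> = - {i})"
      by cases (auto simp: card_1_singleton_iff)
  qed auto
  finally show ?thesis .
qed

lemma lookup_single_times:
  fixes p :: "('a::ab_group_add) \<Rightarrow>\<^sub>0 ('k::field)"
  shows "Poly_Mapping.lookup (Poly_Mapping.single e 1 * p) d = Poly_Mapping.lookup p (d - e)"
proof -
  have "Poly_Mapping.lookup (Poly_Mapping.single e 1 * p) d =
      (\<Sum>l. (1 when e = l) * (\<Sum>q. Poly_Mapping.lookup p q when d = l + q))"
    by (simp add: lookup_mult lookup_single)
  also have "\<dots> = (\<Sum>l. (\<Sum>q. Poly_Mapping.lookup p q when d = l + q) when e = l)"
    by (intro arg_cong[of _ _ Sum_any]) (auto simp: when_def)
  also have "\<dots> = (\<Sum>q. Poly_Mapping.lookup p q when d - e = q)"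
    by (simp add: algebra_simps when_def)
  finally show ?thesis by simp
qed

lemma keys_single_times:
  fixes p :: "('a::ab_group_add) \<Rightarrow>\<^sub>0 ('k::field)"
  shows "Poly_Mapping.keys (Poly_Mapping.single e 1 * p) = (+) e ` Poly_Mapping.keys p"
proof (rule Set.set_eqI)
  fix d :: 'a
  have "d \<in> Poly_Mapping.keys (Poly_Mapping.single e 1 * p) \<longleftrightarrow> d - e \<in> Poly_Mapping.keys p"
    by (simp add: in_keys_iff lookup_single_times)
  also have "\<dots> \<longleftrightarrow> d \<in> (+) e ` Poly_Mapping.keys p"
    by (force simp: image_iff algebra_simps)
  finally show "d \<in> Poly_Mapping.keys (Poly_Mapping.single e 1 * p) \<longleftrightarrow>
    d \<in> (+) e ` Poly_Mapping.keys p" .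
qed

lemma prod_monom:
  "(\<Prod>i\<in>\<sigma>. monom i n :: ('k::field, 'm::finite) laurent) =
    Poly_Mapping.single (\<chi> j. if j \<in> \<sigma> then int n else 0) 1"
proof (induction \<sigma> rule: finite_induct[OF finite])
  case 1
  have "(\<chi> j. 0) = (0 :: int ^ 'm)" by (simp add: vec_eq_iff)
  then show ?case by simp
next
  case (2 i \<sigma>)
  have "axis i (int n) + (\<chi> j. if j \<in> \<sigma> then int n else 0)
      = (\<chi> j. if j \<in> insert i \<sigma> then int n else 0)"
    using 2 by (auto simp: vec_eq_iff axis_def)
  with 2 show ?case by (simp add: monom_def mult_single)
qed

lemma Loc_eq_fractions:
  "(p :: ('k::field, 'm::finite) laurent) \<in> carrier (Loc \<sigma>) \<longleftrightarrow>
     (\<exists>n. (\<Prod>i\<in>\<sigma>. monom i n) * p \<in> carrier (Loc {}))"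
proof -
  have *: "(\<Prod>i\<in>\<sigma>. monom i n) * p \<in> carrier (Loc {}) \<longleftrightarrow>
      (\<forall>d\<in>Poly_Mapping.keys p. \<forall>j. 0 \<le> (if j \<in> \<sigma> then int n else 0) + d $ j)" for n
    by (simp add: Loc_def degrees_def prod_monom keys_single_times image_subset_iff)
  show ?thesis
  proof
    assume p: "p \<in> carrier (Loc \<sigma>)"
    define n where "n = (\<Sum>d\<in>Poly_Mapping.keys p. \<Sum>j\<in>UNIV. nat \<bar>d $ j\<bar>)"
    have "0 \<le> int n + d $ j" if "d \<in> Poly_Mapping.keys p" for d j
    proof -
      have "nat \<bar>d $ j\<bar> \<le> (\<Sum>j\<in>UNIV. nat \<bar>d $ j\<bar>)"
        by (rule member_le_sum) auto
      also have "\<dots> \<le> n"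
        unfolding n_def using that by (intro member_le_sum) auto
      finally show ?thesis by linarith
    qed
    moreover have "0 \<le> d $ j" if "d \<in> Poly_Mapping.keys p" "j \<notin> \<sigma>" for d j
      using p that by (auto simp: Loc_def degrees_def)
    ultimately have "(\<Prod>i\<in>\<sigma>. monom i n) * p \<in> carrier (Loc {})"
      unfolding * by simp
    then show "\<exists>n. (\<Prod>i\<in>\<sigma>. monom i n) * p \<in> carrier (Loc {})" ..
  next
    assume "\<exists>n. (\<Prod>i\<in>\<sigma>. monom i n) * p \<in> carrier (Loc {})"
    then obtain n where
      "\<forall>d\<in>Poly_Mapping.keys p. \<forall>j. 0 \<le> (if j \<in> \<sigma> then int n else 0) + d $ j"
      unfolding * by blast
    then have "0 \<le> d $ j" if "d \<in> Poly_Mapping.keys p" "j \<notin> \<sigma>" for d j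
      using that by (metis add_0)
    then show "p \<in> carrier (Loc \<sigma>)"
      by (auto simp: Loc_def degrees_def)
  qed
qed

lemma cring_Loc: "cring (Loc \<sigma> :: (('k::field, 'm::finite) laurent, _, _) gmodule)"
proof (rule cringI)
  have k: "Poly_Mapping.keys (p * q) \<subseteq> degrees \<sigma>"
    if "Poly_Mapping.keys p \<subseteq> degrees \<sigma>" "Poly_Mapping.keys q \<subseteq> degrees \<sigma>"
    for p q :: "('k, 'm) laurent"
    using keys_mult[of p q] that by (fastforce simp: degrees_def)
  have a: "Poly_Mapping.keys (p + q) \<subseteq> degrees \<sigma>"
    if "Poly_Mapping.keys p \<subseteq> degrees \<sigma>" "Poly_Mapping.keys q \<subseteq> degrees \<sigma>"
    for p q :: "('k, 'm) laurent"
    using Poly_Mapping.keys_add[of p q] that by blast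
  show "abelian_group (Loc \<sigma> :: (('k, 'm) laurent, _, _) gmodule)"
  proof (rule abelian_groupI)
    fix p :: "('k, 'm) laurent"
    assume "p \<in> carrier (Loc \<sigma>)"
    then show "\<exists>q\<in>carrier (Loc \<sigma>). q \<oplus>\<^bsub>Loc \<sigma>\<^esub> p = \<zero>\<^bsub>Loc \<sigma>\<^esub>"
      by (intro bexI[of _ "- p"]) (auto simp: Loc_def)
  qed (auto simp: Loc_def algebra_simps dest: subsetD[OF a])
  have "0 \<in> degrees \<sigma>" by (simp add: degrees_def)
  then show "comm_monoid (Loc \<sigma> :: (('k, 'm) laurent, _, _) gmodule)"
    by (intro comm_monoidI) (auto simp: Loc_def algebra_simps dest: subsetD[OF k])
qed (auto simp: Loc_def algebra_simps)

end

theory Submission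
  imports Defs
begin

text \<open>
  At \<open>[m]\<close> a torsion object vanishes: the value there is spanned by multiples of the
  \<open>\<phi>\<^sub>i(x)\<close>, each of which is killed by a power of \<open>t\<^sub>i\<close>, and \<open>t\<^sub>i\<close> is invertible over
  \<open>R\<^sub>[\<^sub>m\<^sub>]\<close> (\<open>torsion_object_UNIV_zero\<close>).  So the object is just a family of unrelated modules, one
  for each facet \<open>\<sigma>\<^sub>j = - {j}\<close>, and each of them may be decomposed by itself.

  Over \<open>R\<^bsub>\<sigma>\<^sub>j\<^esub>\<close> every variable except \<open>t\<^sub>j\<close> is a homogeneous unit, so a homogeneous element can
  be moved to a degree on the \<open>j\<close>-th axis, and the theory becomes that of \<open>\<nat>\<close>-graded modules over
  \<open>k[t\<^sub>j]\<close>.  Such a module, if it is finitely generated and torsion, is a direct sum of cyclic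
  modules.  The proof is an exchange argument.  Among all families of homogeneous generators
  \<open>x\<^sub>s\<close> in fixed degrees \<open>a\<^sub>s\<close>, take one for which the sum of the orders
  \<open>l\<^sub>s = min {l. t\<^sub>j\<^sup>l x\<^sub>s = 0}\<close> is least.  A homogeneous relation between the \<open>x\<^sub>s\<close> with a
  nonzero term could be divided by the coefficient of a generator \<open>x\<^sub>r\<close> with \<open>a\<^sub>r\<close> largest among
  the nonzero terms: it says that a power of \<open>t\<^sub>j\<close> smaller than \<open>l\<^sub>r\<close> kills the sum of \<open>x\<^sub>r\<close>
  and a combination of the others.  Putting this sum in place of \<open>x\<^sub>r\<close> keeps the degrees and the
  generation but lowers the sum of the orders (\<open>improve_generators\<close>).  Hence in a minimal family
  every relation is trivial, and the generators of positive order form an \<open>interval_basis\<close>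
  (\<open>ex_interval_basis\<close>).

  A module with such a basis and the sum of the objects \<open>[a\<^sub>s, a\<^sub>s + l\<^sub>s)\<^sub>j\<close> have a common
  presentation: both are quotients of the free module on the \<open>x\<^sub>s\<close> by the relations
  \<open>t\<^sub>j\<^bsup>l\<^sub>s\<^esup> x\<^sub>s = 0\<close> (\<open>sum_of_intervals_iso\<close>).  Numbering the basis elements of all facets
  together yields the decomposition.
\<close>

section \<open>Laurent polynomials\<close>

lemma Loc_simps [simp]:
  "r \<oplus>\<^bsub>Loc \<sigma>\<^esub> s = r + s" "r \<otimes>\<^bsub>Loc \<sigma>\<^esub> s = r * s" "\<zero>\<^bsub>Loc \<sigma>\<^esub> = 0" "\<one>\<^bsub>Loc \<sigma>\<^esub> = 1"
  by (simp_all add: Loc_def)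

lemma carrier_Loc_iff: "p \<in> carrier (Loc \<sigma>) \<longleftrightarrow> Poly_Mapping.keys p \<subseteq> degrees \<sigma>"
  by (simp add: Loc_def)

lemma Loc_closed [simp]:
  fixes p q :: "('k::field, 'm::finite) laurent"
  shows "0 \<in> carrier (Loc \<sigma>)" "1 \<in> carrier (Loc \<sigma>)"
    "p \<in> carrier (Loc \<sigma>) \<Longrightarrow> q \<in> carrier (Loc \<sigma>) \<Longrightarrow> p + q \<in> carrier (Loc \<sigma>)"
    "p \<in> carrier (Loc \<sigma>) \<Longrightarrow> q \<in> carrier (Loc \<sigma>) \<Longrightarrow> p * q \<in> carrier (Loc \<sigma>)"
    "p \<in> carrier (Loc \<sigma>) \<Longrightarrow> - p \<in> carrier (Loc \<sigma>)"
    "p \<in> carrier (Loc \<sigma>) \<Longrightarrow> q \<in> carrier (Loc \<sigma>) \<Longrightarrow> p - q \<in> carrier (Loc \<sigma>)"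
proof -
  interpret cring "Loc \<sigma> :: (('k, 'm) laurent, _, _) gmodule" by (rule cring_Loc)
  show "0 \<in> carrier (Loc \<sigma>)" "1 \<in> carrier (Loc \<sigma>)"
    by (simp_all add: carrier_Loc_iff degrees_def)
  show add: "p + q \<in> carrier (Loc \<sigma>)" if "p \<in> carrier (Loc \<sigma>)" "q \<in> carrier (Loc \<sigma>)"
    for p q :: "('k, 'm) laurent"
    using add.m_closed[OF that] by simp
  show "p * q \<in> carrier (Loc \<sigma>)" if "p \<in> carrier (Loc \<sigma>)" "q \<in> carrier (Loc \<sigma>)"
    using m_closed[OF that] by simp
  show minus: "- p \<in> carrier (Loc \<sigma>)" if "p \<in> carrier (Loc \<sigma>)" for p :: "('k, 'm) laurent"
    using that by (simp add: carrier_Loc_iff)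
  show "p - q \<in> carrier (Loc \<sigma>)" if "p \<in> carrier (Loc \<sigma>)" "q \<in> carrier (Loc \<sigma>)"
    using add[OF that(1) minus[OF that(2)]] by simp
qed

lemma single_in_Loc [simp]: "e \<in> degrees \<sigma> \<Longrightarrow> Poly_Mapping.single e c \<in> carrier (Loc \<sigma>)"
  by (simp add: carrier_Loc_iff)

lemma axis_in_degrees [simp]: "axis j (int n) \<in> degrees \<sigma>"
  by (simp add: degrees_def axis_def)

lemma monom_in_Loc [simp]: "monom j n \<in> carrier (Loc \<sigma>)"
  by (simp add: monom_def)

lemma single_lookup_in_Loc [simp]:
  assumes "p \<in> carrier (Loc \<sigma>)"
  shows "Poly_Mapping.single e (Poly_Mapping.lookup p e) \<in> carrier (Loc \<sigma>)"
  using assms by (cases "Poly_Mapping.lookup p e = 0") (auto simp: carrier_Loc_iff in_keys_iff)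

lemma grd_Loc_iff:
  "p \<in> grd (Loc \<sigma>) d \<longleftrightarrow>
    p \<in> carrier (Loc \<sigma>) \<and> p = Poly_Mapping.single d (Poly_Mapping.lookup p d)"
proof -
  have "Poly_Mapping.keys p \<subseteq> {d} \<longleftrightarrow> p = Poly_Mapping.single d (Poly_Mapping.lookup p d)"
    by (auto simp: poly_mapping_eq_iff fun_eq_iff lookup_single when_def in_keys_iff
        dest!: subsetD[of _ "{d}"])
  then show ?thesis by (auto simp: Loc_def)
qed

lemma laurent_eq_sum_of_terms:
  "(p :: ('k::field, 'm::finite) laurent) =
    (\<Sum>e\<in>Poly_Mapping.keys p. Poly_Mapping.single e (Poly_Mapping.lookup p e))"
  by (rule poly_mapping_eqI) (auto simp: lookup_sum lookup_single when_def in_keys_iff sum.delta)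

lemma Pi_mult_closed:
  "p \<in> carrier (Loc \<sigma>) \<Longrightarrow> c \<in> I \<rightarrow> carrier (Loc \<sigma>) \<Longrightarrow> (\<lambda>s. p * c s) \<in> I \<rightarrow> carrier (Loc \<sigma>)"
  by (simp add: Pi_iff)

lemma Pi_add_closed:
  "c \<in> I \<rightarrow> carrier (Loc \<sigma>) \<Longrightarrow> c' \<in> I \<rightarrow> carrier (Loc \<sigma>) \<Longrightarrow>
    (\<lambda>s. c s + c' s) \<in> I \<rightarrow> carrier (Loc \<sigma>)"
  by (simp add: Pi_iff)

section \<open>Graded modules\<close>

locale graded_Loc_module =
  fixes \<sigma> :: "'m::finite set" and M :: "(('k::field, 'm) laurent, 'a, int ^ 'm) gmodule" (structure)
  assumes graded: "graded_module \<sigma> M"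
begin

sublocale module "Loc \<sigma>" M
  using graded by (simp add: graded_module_def)

lemma smult_add_left:
  "p \<in> carrier (Loc \<sigma>) \<Longrightarrow> q \<in> carrier (Loc \<sigma>) \<Longrightarrow> x \<in> carrier M \<Longrightarrow>
    (p + q) \<odot> x = p \<odot> x \<oplus> q \<odot> x"
  using smult_l_distr by simp

lemma smult_mult:
  "p \<in> carrier (Loc \<sigma>) \<Longrightarrow> q \<in> carrier (Loc \<sigma>) \<Longrightarrow> x \<in> carrier M \<Longrightarrow>
    (p * q) \<odot> x = p \<odot> (q \<odot> x)"
  using smult_assoc1 by simp

lemma smult_1 [simp]: "x \<in> carrier M \<Longrightarrow> 1 \<odot> x = x"
  using smult_one by simp

lemma smult_0 [simp]: "x \<in> carrier M \<Longrightarrow> 0 \<odot> x = \<zero>"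
  using smult_l_null by simp

lemma smult_uminus:
  assumes "p \<in> carrier (Loc \<sigma>)" "x \<in> carrier M" shows "(- p) \<odot> x = \<ominus> (p \<odot> x)"
proof -
  have "(- p) \<odot> x \<oplus> p \<odot> x = \<zero>"
    using smult_add_left[of "- p" p x] assms by simp
  then show ?thesis
    using assms by (simp add: M.minus_equality)
qed

lemma grd_subgroup: "additive_subgroup (grd M d) M"
  using graded by (simp add: graded_module_def)

lemma grd_carrier [simp, intro]: "x \<in> grd M d \<Longrightarrow> x \<in> carrier M"
  using additive_subgroup.a_subset[OF grd_subgroup] by blast

lemma grd_zero [simp]: "\<zero> \<in> grd M d"
  by (rule additive_subgroup.zero_closed[OF grd_subgroup])

lemma grd_add: "x \<in> grd M d \<Longrightarrow> y \<in> grd M d \<Longrightarrow> x \<oplus> y \<in> grd M d"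
  by (rule additive_subgroup.a_closed[OF grd_subgroup])

lemma grd_outside: "x \<in> grd M d \<Longrightarrow> x \<noteq> \<zero> \<Longrightarrow> d \<in> degrees \<sigma>"
  using graded by (auto simp: graded_module_def)

lemma grd_smult: "p \<in> grd (Loc \<sigma>) d \<Longrightarrow> x \<in> grd M e \<Longrightarrow> p \<odot> x \<in> grd M (d + e)"
  using graded by (auto simp: graded_module_def)

lemma grd_finsum: "(\<And>s. s \<in> I \<Longrightarrow> f s \<in> grd M d) \<Longrightarrow> (\<Oplus>s\<in>I. f s) \<in> grd M d"
proof (induction I rule: infinite_finite_induct)
  case (insert s I)
  then have "f \<in> I \<rightarrow> carrier M" "f s \<in> carrier M" by auto
  with insert show ?case by (simp add: grd_add)
qed (auto simp: M.finsum_infinite)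

lemma single_smult_grd:
  assumes "x \<in> grd M e" "Poly_Mapping.single d c \<in> carrier (Loc \<sigma>)"
  shows "Poly_Mapping.single d c \<odot> x \<in> grd M (d + e)"
  using assms by (intro grd_smult) (simp_all add: grd_Loc_iff)

text \<open>
  The homogeneous components are named so that identities between combinations of homogeneous
  elements can be compared degree by degree.
\<close>

definition decomposition :: "'a \<Rightarrow> (int ^ 'm \<Rightarrow> 'a) \<Rightarrow> bool" where
  "decomposition x c \<longleftrightarrow> (\<forall>d. c d \<in> grd M d) \<and> finite {d. c d \<noteq> \<zero>} \<and>
     x = (\<Oplus>d\<in>{d. c d \<noteq> \<zero>}. c d)"

lemma ex1_decomposition: "x \<in> carrier M \<Longrightarrow> \<exists>!c. decomposition x c"
  using graded by (simp add: graded_module_def decomposition_def)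

definition component :: "int ^ 'm \<Rightarrow> 'a \<Rightarrow> 'a" where
  "component d x = (THE c. decomposition x c) d"

lemma decomposition_component: "x \<in> carrier M \<Longrightarrow> decomposition x (\<lambda>d. component d x)"
  unfolding component_def using theI'[OF ex1_decomposition] by simp

lemma component_eqI:
  assumes "\<And>d. c d \<in> grd M d" "finite D" "\<And>d. d \<notin> D \<Longrightarrow> c d = \<zero>" "x = (\<Oplus>d\<in>D. c d)"
  shows "component d x = c d"
proof -
  have c: "c \<in> D \<rightarrow> carrier M" using assms(1) by auto
  have "(\<Oplus>d\<in>D. c d) = (\<Oplus>d\<in>{d. c d \<noteq> \<zero>}. c d)"
    by (rule M.add.finprod_mono_neutral_cong_right) (use assms c in auto)
  moreover have "finite {d. c d \<noteq> \<zero>}"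
    by (rule finite_subset[OF _ assms(2)]) (use assms(3) in auto)
  ultimately have "decomposition x c"
    using assms by (simp add: decomposition_def)
  moreover have "x \<in> carrier M" using c assms(4) by simp
  ultimately have "(THE c. decomposition x c) = c"
    using ex1_decomposition by (intro the1_equality)
  then show ?thesis by (simp add: component_def)
qed

lemma component_grd [simp]: "x \<in> carrier M \<Longrightarrow> component d x \<in> grd M d"
  using decomposition_component by (simp add: decomposition_def)

lemma component_carrier [simp]: "x \<in> carrier M \<Longrightarrow> component d x \<in> carrier M"
  by (blast intro: component_grd)

lemma finite_components: "x \<in> carrier M \<Longrightarrow> finite {d. component d x \<noteq> \<zero>}"
  using decomposition_component by (simp add: decomposition_def)

lemma sum_components: "x \<in> carrier M \<Longrightarrow> x = (\<Oplus>d\<in>{d. component d x \<noteq> \<zero>}. component d x)"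
  using decomposition_component by (simp add: decomposition_def)

lemma component_homogeneous:
  assumes "x \<in> grd M e" shows "component d x = (if d = e then x else \<zero>)"
  by (rule component_eqI[where D = "{e}"]) (use assms in auto)

lemma component_zero [simp]: "component d \<zero> = \<zero>"
  using component_homogeneous[OF grd_zero, of d] by (simp split: if_splits)

lemma component_add:
  assumes "x \<in> carrier M" "y \<in> carrier M"
  shows "component d (x \<oplus> y) = component d x \<oplus> component d y"
proof -
  define D where "D = {d. component d x \<noteq> \<zero>} \<union> {d. component d y \<noteq> \<zero>}"
  have D: "finite D" using assms finite_components by (simp add: D_def)
  show ?thesis
  proof (rule component_eqI[where D = D])
    have "(\<Oplus>d\<in>D. component d x) = x"
      by (rule trans[OF M.add.finprod_mono_neutral_cong_right sum_components[symmetric]])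
        (use D assms in \<open>auto simp: D_def\<close>)
    moreover have "(\<Oplus>d\<in>D. component d y) = y"
      by (rule trans[OF M.add.finprod_mono_neutral_cong_right sum_components[symmetric]])
        (use D assms in \<open>auto simp: D_def\<close>)
    moreover have "(\<Oplus>d\<in>D. component d x \<oplus> component d y)
        = (\<Oplus>d\<in>D. component d x) \<oplus> (\<Oplus>d\<in>D. component d y)"
      using assms by (intro M.finsum_addf) auto
    ultimately show "x \<oplus> y = (\<Oplus>d\<in>D. component d x \<oplus> component d y)" by simp
  qed (use D assms in \<open>auto simp: D_def grd_add\<close>)
qed

lemma component_finsum:
  "(\<And>s. s \<in> I \<Longrightarrow> f s \<in> carrier M) \<Longrightarrow> component d (\<Oplus>s\<in>I. f s) = (\<Oplus>s\<in>I. component d (f s))"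
proof (induction I rule: infinite_finite_induct)
  case (insert s I)
  then have "f \<in> I \<rightarrow> carrier M" "f s \<in> carrier M" "(\<lambda>s. component d (f s)) \<in> I \<rightarrow> carrier M"
    by auto
  with insert show ?case by (simp add: component_add)
qed (auto simp: M.finsum_infinite)

lemma smult_eq_sum_of_terms:
  assumes p: "p \<in> carrier (Loc \<sigma>)" and x: "x \<in> carrier M"
  shows "p \<odot> x = (\<Oplus>e\<in>Poly_Mapping.keys p. Poly_Mapping.single e (Poly_Mapping.lookup p e) \<odot> x)"
proof -
  let ?t = "\<lambda>e. Poly_Mapping.single e (Poly_Mapping.lookup p e)"
  have "(\<Sum>e\<in>E. ?t e) \<in> carrier (Loc \<sigma>) \<and> (\<Sum>e\<in>E. ?t e) \<odot> x = (\<Oplus>e\<in>E. ?t e \<odot> x)"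
    if "finite E" for E
    using that
  proof (induction E)
    case (insert e E)
    then have "(\<lambda>e. ?t e \<odot> x) \<in> E \<rightarrow> carrier M" using p x by auto
    with insert p x show ?case by (simp add: smult_add_left)
  qed (use x in simp)
  from this[of "Poly_Mapping.keys p"] show ?thesis
    by (simp flip: laurent_eq_sum_of_terms)
qed

lemma component_smult:
  assumes p: "p \<in> carrier (Loc \<sigma>)" and x: "x \<in> grd M e"
  shows "component d (p \<odot> x) = Poly_Mapping.single (d - e) (Poly_Mapping.lookup p (d - e)) \<odot> x"
proof (rule component_eqI[where D = "(\<lambda>f. f + e) ` Poly_Mapping.keys p"])
  show "Poly_Mapping.single (d - e) (Poly_Mapping.lookup p (d - e)) \<odot> x \<in> grd M d" for d
    using single_smult_grd[OF x single_lookup_in_Loc[OF p, of "d - e"]] by simp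
  show "p \<odot> x = (\<Oplus>d\<in>(\<lambda>f. f + e) ` Poly_Mapping.keys p.
      Poly_Mapping.single (d - e) (Poly_Mapping.lookup p (d - e)) \<odot> x)"
    using p x
    by (subst M.finsum_reindex) (auto simp: inj_on_def smult_eq_sum_of_terms[OF p, of x])
  show "Poly_Mapping.single (d - e) (Poly_Mapping.lookup p (d - e)) \<odot> x = \<zero>"
    if "d \<notin> (\<lambda>f. f + e) ` Poly_Mapping.keys p" for d
  proof -
    have "d - e \<notin> Poly_Mapping.keys p" using that by (force simp: image_iff)
    then show ?thesis using x by (simp add: in_keys_iff)
  qed
qed simp

lemma combination_closed:
  "c \<in> I \<rightarrow> carrier (Loc \<sigma>) \<Longrightarrow> X ` I \<subseteq> carrier M \<Longrightarrow> (\<lambda>s. c s \<odot> X s) \<in> I \<rightarrow> carrier M"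
  by (auto dest: funcset_mem)

lemma combination_smult:
  assumes fin: "finite I" and X: "X ` I \<subseteq> carrier M"
    and p: "p \<in> carrier (Loc \<sigma>)" and c: "c \<in> I \<rightarrow> carrier (Loc \<sigma>)"
  shows "p \<odot> (\<Oplus>s\<in>I. c s \<odot> X s) = (\<Oplus>s\<in>I. (p * c s) \<odot> X s)"
proof -
  have "p \<odot> (\<Oplus>s\<in>I. c s \<odot> X s) = (\<Oplus>s\<in>I. p \<odot> (c s \<odot> X s))"
    by (rule finsum_smult_ldistr[OF fin p combination_closed[OF c X]])
  also have "\<dots> = (\<Oplus>s\<in>I. (p * c s) \<odot> X s)"
    by (rule M.finsum_cong'[OF refl combination_closed[OF Pi_mult_closed[OF p c] X]])
      (use X p c in \<open>simp_all add: smult_mult Pi_iff image_subset_iff\<close>)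
  finally show ?thesis .
qed

lemma combination_add:
  assumes X: "X ` I \<subseteq> carrier M"
    and c: "c \<in> I \<rightarrow> carrier (Loc \<sigma>)" and c': "c' \<in> I \<rightarrow> carrier (Loc \<sigma>)"
  shows "(\<Oplus>s\<in>I. c s \<odot> X s) \<oplus> (\<Oplus>s\<in>I. c' s \<odot> X s) = (\<Oplus>s\<in>I. (c s + c' s) \<odot> X s)"
proof -
  have "(\<Oplus>s\<in>I. c s \<odot> X s) \<oplus> (\<Oplus>s\<in>I. c' s \<odot> X s) = (\<Oplus>s\<in>I. c s \<odot> X s \<oplus> c' s \<odot> X s)"
    by (rule M.finsum_addf[OF combination_closed[OF c X] combination_closed[OF c' X], symmetric])
  also have "\<dots> = (\<Oplus>s\<in>I. (c s + c' s) \<odot> X s)"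
    by (rule M.finsum_cong'[OF refl combination_closed[OF Pi_add_closed[OF c c'] X]])
      (use X c c' in \<open>simp_all add: smult_add_left Pi_iff image_subset_iff\<close>)
  finally show ?thesis .
qed

text \<open>
  Taking one component of a combination of homogeneous generators turns it into a combination with
  homogeneous coefficients.  So relations, as well as expressions of homogeneous elements, may be
  assumed to be homogeneous.
\<close>

lemma component_combination:
  assumes "\<And>s. s \<in> I \<Longrightarrow> X s \<in> grd M (g s)" "p \<in> I \<rightarrow> carrier (Loc \<sigma>)"
  shows "component d (\<Oplus>s\<in>I. p s \<odot> X s) =
    (\<Oplus>s\<in>I. Poly_Mapping.single (d - g s) (Poly_Mapping.lookup (p s) (d - g s)) \<odot> X s)"
proof -
  have "component d (\<Oplus>s\<in>I. p s \<odot> X s) = (\<Oplus>s\<in>I. component d (p s \<odot> X s))"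
    using assms by (intro component_finsum) (auto intro!: smult_closed dest: funcset_mem)
  also have "\<dots> = (\<Oplus>s\<in>I. Poly_Mapping.single (d - g s) (Poly_Mapping.lookup (p s) (d - g s)) \<odot> X s)"
  proof (rule M.finsum_cong')
    show "(\<lambda>s. Poly_Mapping.single (d - g s) (Poly_Mapping.lookup (p s) (d - g s)) \<odot> X s) \<in> I \<rightarrow> carrier M"
      using assms by (auto intro!: smult_closed single_lookup_in_Loc dest: funcset_mem)
    show "component d (p s \<odot> X s) =
        Poly_Mapping.single (d - g s) (Poly_Mapping.lookup (p s) (d - g s)) \<odot> X s"
      if "s \<in> I" for s
      using component_smult[OF funcset_mem[OF assms(2) that] assms(1)[OF that]] .
  qed simp
  finally show ?thesis .
qed

end

section \<open>Torsion modules over one facet\<close>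

lemma degrees_facet [simp]: "d \<in> degrees (- {j}) \<longleftrightarrow> 0 \<le> d $ j"
  by (simp add: degrees_def)

text \<open>
  Ideals generated by a power of \<open>t\<^sub>j\<close> are monomial, so divisibility can be tested term by term,
  and only the \<open>j\<close>-th exponent matters because the other variables are units.
\<close>

lemma divisible_by_monom:
  fixes p :: "('k::field, 'm::finite) laurent"
  assumes "\<And>e. e \<in> Poly_Mapping.keys p \<Longrightarrow> int n \<le> e $ j"
  shows "\<exists>q\<in>carrier (Loc (- {j})). p = monom j n * q"
proof
  let ?q = "Poly_Mapping.single (- axis j (int n)) 1 * p"
  show "?q \<in> carrier (Loc (- {j}))"
    using assms by (force simp: carrier_Loc_iff keys_single_times)
  show "p = monom j n * ?q"
    by (simp add: monom_def mult.assoc[symmetric] mult_single)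
qed

text \<open>
  The elements \<open>X s\<close>, in degrees \<open>a s\<close> on the \<open>j\<close>-th axis, present \<open>M\<close> as the direct sum of
  the cyclic modules \<open>R\<^sub>\<sigma> / t\<^sub>j\<^bsup>l s\<^esup> R\<^sub>\<sigma>\<close> for \<open>\<sigma> = - {j}\<close>, shifted by \<open>a s\<close>: all relations between
  them are consequences of \<open>t\<^sub>j\<^bsup>l s\<^esup> X s = 0\<close>.
\<close>

definition interval_basis ::
  "'m \<Rightarrow> (('k::field, 'm::finite) laurent, 'a, int ^ 'm) gmodule \<Rightarrow>
    's set \<Rightarrow> ('s \<Rightarrow> 'a) \<Rightarrow> ('s \<Rightarrow> nat) \<Rightarrow> ('s \<Rightarrow> nat) \<Rightarrow> bool" where
  "interval_basis j M I X a l \<longleftrightarrow> finite I \<and>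
     (\<forall>s\<in>I. 0 < l s \<and> X s \<in> grd M (axis j (int (a s))) \<and> monom j (l s) \<odot>\<^bsub>M\<^esub> X s = \<zero>\<^bsub>M\<^esub>) \<and>
     (\<forall>y\<in>carrier M. \<exists>c\<in>I \<rightarrow> carrier (Loc (- {j})). y = (\<Oplus>\<^bsub>M\<^esub>s\<in>I. c s \<odot>\<^bsub>M\<^esub> X s)) \<and>
     (\<forall>p\<in>I \<rightarrow> carrier (Loc (- {j})). (\<Oplus>\<^bsub>M\<^esub>s\<in>I. p s \<odot>\<^bsub>M\<^esub> X s) = \<zero>\<^bsub>M\<^esub> \<longrightarrow>
       (\<forall>s\<in>I. \<exists>q\<in>carrier (Loc (- {j})). p s = monom j (l s) * q))"

locale torsion_facet_module = graded_Loc_module "- {j}" M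
  for j :: "'m::finite" and M :: "(('k::field, 'm) laurent, 'a, int ^ 'm) gmodule" (structure) +
  assumes torsion: "x \<in> carrier M \<Longrightarrow> \<exists>n. monom j n \<odot> x = \<zero>"
begin

definition torsion_order :: "'a \<Rightarrow> nat" where
  "torsion_order x = (LEAST n. monom j n \<odot> x = \<zero>)"

lemma torsion_order: "x \<in> carrier M \<Longrightarrow> monom j (torsion_order x) \<odot> x = \<zero>"
  unfolding torsion_order_def by (rule LeastI_ex[OF torsion])

text \<open>
  A single term differs from a power of \<open>t\<^sub>j\<close> by a unit, so whether it kills \<open>x\<close> can be read
  off from its \<open>j\<close>-th exponent.
\<close>

lemma single_smult_eq_zero_iff:
  assumes e: "0 \<le> e $ j" and c: "c \<noteq> 0" and x: "x \<in> carrier M"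
  shows "Poly_Mapping.single e c \<odot> x = \<zero> \<longleftrightarrow> torsion_order x \<le> nat (e $ j)"
proof
  assume 0: "Poly_Mapping.single e c \<odot> x = \<zero>"
  let ?u = "Poly_Mapping.single (axis j (e $ j) - e) (1 / c) :: ('k, 'm) laurent"
  have "monom j (nat (e $ j)) = ?u * Poly_Mapping.single e c"
    using e c by (simp add: monom_def mult_single)
  moreover have "?u \<in> carrier (Loc (- {j}))" by simp
  ultimately have "monom j (nat (e $ j)) \<odot> x = \<zero>"
    using 0 e x by (simp add: smult_mult)
  then show "torsion_order x \<le> nat (e $ j)"
    unfolding torsion_order_def by (rule Least_le)
next
  assume l: "torsion_order x \<le> nat (e $ j)"
  let ?l = "torsion_order x"
  have "Poly_Mapping.single e c = Poly_Mapping.single (e - axis j (int ?l)) c * monom j ?l"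
    by (simp add: monom_def mult_single)
  moreover have "Poly_Mapping.single (e - axis j (int ?l)) c \<in> carrier (Loc (- {j}))"
    using l e by simp
  ultimately show "Poly_Mapping.single e c \<odot> x = \<zero>"
    using x by (simp add: smult_mult torsion_order)
qed

lemma torsion_order_eq_0: "x \<in> carrier M \<Longrightarrow> torsion_order x = 0 \<Longrightarrow> x = \<zero>"
  using torsion_order[of x] by (simp add: monom_def axis_def flip: zero_vec_def)

text \<open>
  Generation is phrased with submodules and not with explicit combinations: an exchange of one
  generator then only requires showing that the old generator lies in every submodule that
  contains the new family.
\<close>

definition generates :: "'a set \<Rightarrow> bool" where
  "generates Y \<longleftrightarrow> (\<forall>H. submodule H (Loc (- {j})) M \<longrightarrow> Y \<subseteq> H \<longrightarrow> carrier M \<subseteq> H)"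

lemma submodule_finsum:
  assumes H: "submodule H (Loc (- {j})) M" and f: "\<And>s. s \<in> I \<Longrightarrow> f s \<in> H"
  shows "(\<Oplus>s\<in>I. f s) \<in> H"
proof -
  have zero: "\<zero> \<in> H"
    using subgroup.one_closed[OF submodule.axioms(1)[OF H]] by simp
  show ?thesis
    using f
  proof (induction I rule: infinite_finite_induct)
    case (insert s I)
    then have "f \<in> I \<rightarrow> carrier M" "f s \<in> carrier M"
      using submoduleE(1)[OF H] by auto
    with insert show ?case by (simp add: submoduleE(5)[OF H])
  qed (use zero in \<open>auto simp: M.finsum_infinite\<close>)
qed

lemma generates_combination:
  assumes fin: "finite I" and X: "X ` I \<subseteq> carrier M" and gen: "generates (X ` I)"
    and y: "y \<in> carrier M"
  shows "\<exists>c\<in>I \<rightarrow> carrier (Loc (- {j})). y = (\<Oplus>s\<in>I. c s \<odot> X s)"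
proof -
  define H where "H = {\<Oplus>s\<in>I. c s \<odot> X s | c. c \<in> I \<rightarrow> carrier (Loc (- {j}))}"
  have "submodule H (Loc (- {j})) M"
  proof (rule submoduleI)
    show "H \<subseteq> carrier M"
      using combination_closed[OF _ X] by (auto simp: H_def)
    have Xs: "X s \<in> carrier M" if "s \<in> I" for s using X that by auto
    have "(\<Oplus>s\<in>I. 0 \<odot> X s) = \<zero>"
      using Xs by (simp add: M.add.finprod_one_eqI)
    then show "\<zero> \<in> H"
      unfolding H_def by (intro CollectI exI[of _ "\<lambda>_. 0"]) auto
    have smult: "p \<odot> x \<in> H" if p: "p \<in> carrier (Loc (- {j}))" and "x \<in> H" for p x
    proof -
      from \<open>x \<in> H\<close> obtain c where c: "c \<in> I \<rightarrow> carrier (Loc (- {j}))" "x = (\<Oplus>s\<in>I. c s \<odot> X s)"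
        by (auto simp: H_def)
      then show ?thesis
        unfolding H_def using combination_smult[OF fin X p c(1)] Pi_mult_closed[OF p c(1)] by auto
    qed
    then show "p \<odot> x \<in> H" if "p \<in> carrier (Loc (- {j}))" "x \<in> H" for p x
      using that .
    show "\<ominus> x \<in> H" if "x \<in> H" for x
      using smult[of "- 1" x] that \<open>H \<subseteq> carrier M\<close> smult_uminus[of 1 x] by auto
    show "x \<oplus> y \<in> H" if "x \<in> H" "y \<in> H" for x y
    proof -
      from that obtain c c' where c: "c \<in> I \<rightarrow> carrier (Loc (- {j}))" "x = (\<Oplus>s\<in>I. c s \<odot> X s)"
        "c' \<in> I \<rightarrow> carrier (Loc (- {j}))" "y = (\<Oplus>s\<in>I. c' s \<odot> X s)"
        by (auto simp: H_def)
      then show ?thesis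
        unfolding H_def using combination_add[OF X c(1,3)] Pi_add_closed[OF c(1,3)] by auto
    qed
  qed
  moreover have "X ` I \<subseteq> H"
  proof
    fix x assume "x \<in> X ` I"
    then obtain t where t: "t \<in> I" "x = X t" by auto
    have "(\<Oplus>s\<in>I. (if s = t then 1 else 0) \<odot> X s) = (\<Oplus>s\<in>I. if s = t then X s else \<zero>)"
      by (rule M.finsum_cong') (use X in auto)
    also have "\<dots> = X t"
      using X by (intro M.add.finprod_singleton_swap t fin) auto
    finally show "x \<in> H"
      unfolding H_def t(2) by (intro CollectI exI[of _ "\<lambda>s. if s = t then 1 else 0"]) auto
  qed
  ultimately show ?thesis
    using gen y unfolding generates_def H_def by blast
qed

text \<open>
  The components of finitely many generators generate.  Multiplying a component of degree \<open>d\<close> by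
  the unit of degree \<open>d\<^sub>j e\<^sub>j - d\<close> moves it to the \<open>j\<close>-th axis.
\<close>

lemma homogeneous_generators:
  assumes "finitely_generated (Loc (- {j})) M"
  shows "\<exists>(I :: ('a \<times> (int ^ 'm)) set) X a. finite I \<and>
    (\<forall>s\<in>I. X s \<in> grd M (axis j (int (a s)))) \<and> generates (X ` I)"
proof -
  from assms obtain A where A: "finite A" "A \<subseteq> carrier M"
    "\<And>x. x \<in> carrier M \<Longrightarrow> \<exists>c\<in>A \<rightarrow> carrier (Loc (- {j})). x = (\<Oplus>a\<in>A. c a \<odot> a)"
    by (auto simp: finitely_generated_def)
  define I where "I = Sigma A (\<lambda>y. {d. component d y \<noteq> \<zero>})"
  define u :: "int ^ 'm \<Rightarrow> ('k, 'm) laurent"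
    where "u = (\<lambda>d. Poly_Mapping.single (axis j (d $ j) - d) 1)"
  define v :: "int ^ 'm \<Rightarrow> ('k, 'm) laurent"
    where "v = (\<lambda>d. Poly_Mapping.single (d - axis j (d $ j)) 1)"
  have uv: "u d \<in> carrier (Loc (- {j}))" "v d \<in> carrier (Loc (- {j}))" "v d * u d = 1" for d
    by (simp_all add: u_def v_def mult_single)
  define X where "X = (\<lambda>(y, d). u d \<odot> component d y)"
  define a where "a = (\<lambda>(y :: 'a, d :: int ^ 'm). nat (d $ j))"
  have "X s \<in> grd M (axis j (int (a s)))" if "s \<in> I" for s
  proof -
    obtain y d where s: "s = (y, d)" by (cases s)
    with that A have y: "y \<in> carrier M" "component d y \<noteq> \<zero>" by (auto simp: I_def)
    have "0 \<le> d $ j" using grd_outside[OF component_grd] y by auto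
    then show ?thesis
      using single_smult_grd[OF component_grd[OF y(1), of d] uv(1)[of d, unfolded u_def]]
      by (simp add: s X_def a_def u_def)
  qed
  moreover have "finite I"
    unfolding I_def
  proof (rule finite_SigmaI[OF A(1)])
    show "finite {d. component d y \<noteq> \<zero>}" if "y \<in> A" for y
      using that A(2) by (intro finite_components) auto
  qed
  moreover have "generates (X ` I)"
    unfolding generates_def
  proof (intro allI impI)
    fix H assume H: "submodule H (Loc (- {j})) M" and sub: "X ` I \<subseteq> H"
    have "y \<in> H" if "y \<in> A" for y
    proof -
      have y: "y \<in> carrier M" using that A by auto
      have "component d y \<in> H" if "component d y \<noteq> \<zero>" for d
      proof -
        have "(y, d) \<in> I" using that \<open>y \<in> A\<close> by (simp add: I_def)
        then have "X (y, d) \<in> H" using sub by blast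
        then have "u d \<odot> component d y \<in> H" by (simp add: X_def)
        then have "v d \<odot> (u d \<odot> component d y) \<in> H"
          using submoduleE(4)[OF H] uv by blast
        then show ?thesis
          using smult_mult[OF uv(2,1) component_carrier[OF y], of d d d] y by (simp add: uv(3))
      qed
      then have "(\<Oplus>d\<in>{d. component d y \<noteq> \<zero>}. component d y) \<in> H"
        by (intro submodule_finsum[OF H]) simp
      with sum_components[OF y] show ?thesis by (rule ssubst[where P = "\<lambda>x. x \<in> H"])
    qed
    then have AH: "(\<Oplus>y\<in>A. c y \<odot> y) \<in> H" if "c \<in> A \<rightarrow> carrier (Loc (- {j}))" for c
      using funcset_mem[OF that] by (intro submodule_finsum[OF H] submoduleE(4)[OF H])
    show "carrier M \<subseteq> H"
    proof
      fix x assume "x \<in> carrier M"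
      from A(3)[OF this] obtain c where "c \<in> A \<rightarrow> carrier (Loc (- {j}))" "x = (\<Oplus>y\<in>A. c y \<odot> y)"
        by (elim bexE)
      with AH show "x \<in> H" by simp
    qed
  qed
  ultimately have "finite I \<and> (\<forall>s\<in>I. X s \<in> grd M (axis j (int (a s)))) \<and> generates (X ` I)"
    by simp
  then show ?thesis by blast
qed

text \<open>
  A homogeneous relation with a nonzero term \<open>p t \<odot> X t\<close> allows an exchange.  It is
  divided by the coefficient of a generator \<open>X r\<close> whose degree is maximal among the generators
  with nonzero term; maximality makes the quotients polynomial in \<open>t\<^sub>j\<close>.  The resulting element is
  killed by the power of \<open>t\<^sub>j\<close> occurring in \<open>p r\<close>, which does not kill \<open>X r\<close>.
\<close>

lemma improve_generators:
  assumes fin: "finite I" and X: "\<And>s. s \<in> I \<Longrightarrow> X s \<in> grd M (axis j (int (a s)))"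
    and gen: "generates (X ` I)"
    and p: "\<And>s. s \<in> I \<Longrightarrow> p s \<in> grd (Loc (- {j})) (d - axis j (int (a s)))"
    and rel: "(\<Oplus>s\<in>I. p s \<odot> X s) = \<zero>"
    and t: "t \<in> I" "p t \<odot> X t \<noteq> \<zero>"
  shows "\<exists>X'. (\<forall>s\<in>I. X' s \<in> grd M (axis j (int (a s)))) \<and> generates (X' ` I) \<and>
    (\<Sum>s\<in>I. torsion_order (X' s)) < (\<Sum>s\<in>I. torsion_order (X s))"
proof -
  have Xc [simp]: "X s \<in> carrier M" if "s \<in> I" for s using X that by auto
  define S where "S = {s \<in> I. p s \<odot> X s \<noteq> \<zero>}"
  have S: "finite S" "S \<noteq> {}" using fin t by (auto simp: S_def)
  then have "Max (a ` S) \<in> a ` S" by simp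
  then obtain r where r: "r \<in> S" and r_eq: "Max (a ` S) = a r" by blast
  have r_max: "a s \<le> a r" if "s \<in> S" for s
    using Max_ge[of "a ` S" "a s"] S that by (simp add: r_eq)
  have rI: "r \<in> I" using r by (simp add: S_def)
  define e where "e s = d - axis j (int (a s))" for s
  define c where "c s = Poly_Mapping.lookup (p s) (e s)" for s
  have p_eq: "p s = Poly_Mapping.single (e s) (c s)" and pc [simp]: "p s \<in> carrier (Loc (- {j}))"
    if "s \<in> I" for s
    using p[OF that] by (simp_all add: grd_Loc_iff e_def c_def)
  have c: "c s \<noteq> 0" if "s \<in> S" for s
    using that p_eq[of s] by (auto simp: S_def)
  have e: "0 \<le> e s $ j" if "s \<in> S" for s
    using c[OF that] pc[of s] p_eq[of s] that by (simp add: S_def carrier_Loc_iff)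
  \<comment> \<open>The relation divided by \<open>p r\<close>, with the terms that already vanish left out.\<close>
  define q where "q s = (if s \<in> S then Poly_Mapping.single (axis j (int (a r - a s))) (c s / c r) else 0)"
    for s
  have q [simp]: "q s \<in> carrier (Loc (- {j}))" for s
    by (simp add: q_def axis_def)
  have q_r: "q r = 1"
    using r c by (simp add: q_def axis_def flip: zero_vec_def)
  have qX: "(\<lambda>s. q s \<odot> X s) \<in> J \<rightarrow> carrier M" if "J \<subseteq> I" for J
    using that by auto
  define x where "x = (\<Oplus>s\<in>I. q s \<odot> X s)"
  have x: "x \<in> carrier M" using qX by (simp add: x_def)
  have "q s \<odot> X s \<in> grd M (axis j (int (a r)))" if "s \<in> I" for s
  proof (cases "s \<in> S")
    case True
    have "axis j (int (a r - a s)) + axis j (int (a s)) = axis j (int (a r))"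
      using r_max[OF True] by (simp add: vec_eq_iff axis_def)
    then show ?thesis
      using single_smult_grd[OF X[OF that], of "axis j (int (a r - a s))" "c s / c r"] True
      by (simp add: q_def)
  qed (use that in \<open>simp add: q_def\<close>)
  then have x_grd: "x \<in> grd M (axis j (int (a r)))"
    unfolding x_def by (rule grd_finsum)
  have "p r \<odot> x = (\<Oplus>s\<in>I. p r \<odot> (q s \<odot> X s))"
    unfolding x_def using finsum_smult_ldistr[OF fin pc[OF rI] qX] by simp
  also have "\<dots> = (\<Oplus>s\<in>I. p s \<odot> X s)"
  proof (rule M.finsum_cong')
    show "p r \<odot> (q s \<odot> X s) = p s \<odot> X s" if s: "s \<in> I" for s
    proof (cases "s \<in> S")
      case True
      have "e r + axis j (int (a r - a s)) = e s"
        using r_max[OF True] by (simp add: e_def vec_eq_iff axis_def)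
      then have "p r * q s = p s"
        using True c[OF r] by (simp add: p_eq rI s q_def mult_single)
      then show ?thesis
        using s rI by (simp flip: smult_mult)
    next
      case False
      then show ?thesis using s rI by (simp add: q_def S_def)
    qed
  qed auto
  finally have "Poly_Mapping.single (e r) (c r) \<odot> x = \<zero>"
    using rel rI by (simp add: p_eq)
  then have "torsion_order x \<le> nat (e r $ j)"
    using single_smult_eq_zero_iff e[OF r] c[OF r] x by blast
  moreover have "\<not> torsion_order (X r) \<le> nat (e r $ j)"
    using single_smult_eq_zero_iff[OF e[OF r] c[OF r] Xc[OF rI]] r p_eq[OF rI] by (simp add: S_def)
  ultimately have less: "torsion_order x < torsion_order (X r)" by simp
  define X' where "X' = X(r := x)"
  have "(\<Sum>s\<in>I. torsion_order (X' s)) < (\<Sum>s\<in>I. torsion_order (X s))"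
    by (rule sum_strict_mono_ex1) (use fin less rI in \<open>auto simp: X'_def\<close>)
  moreover have "generates (X' ` I)"
    unfolding generates_def
  proof (intro allI impI)
    fix H assume H: "submodule H (Loc (- {j})) M" and sub: "X' ` I \<subseteq> H"
    have others: "X s \<in> H" if "s \<in> I" "s \<noteq> r" for s
      using sub that by (force simp: X'_def)
    define z where "z = (\<Oplus>s\<in>I - {r}. q s \<odot> X s)"
    have z: "z \<in> H" "z \<in> carrier M"
      unfolding z_def using others qX[of "I - {r}"]
      by (auto intro!: submodule_finsum[OF H] submoduleE(4)[OF H])
    have "x = X r \<oplus> z"
    proof -
      have "x = (\<Oplus>s\<in>insert r (I - {r}). q s \<odot> X s)"
        unfolding x_def using rI by (simp add: insert_absorb)
      also have "\<dots> = q r \<odot> X r \<oplus> z"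
        unfolding z_def using fin qX[of "I - {r}"] rI by (subst M.finsum_insert) auto
      finally show ?thesis using rI by (simp add: q_r)
    qed
    then have "X r = x \<oplus> \<ominus> z"
      using z rI by (simp add: M.a_assoc M.r_neg)
    moreover have "x \<in> H" using sub rI by (force simp: X'_def)
    ultimately have "X r \<in> H"
      using z submoduleE(3,5)[OF H] by simp
    with others have "X ` I \<subseteq> H" by auto
    with gen H show "carrier M \<subseteq> H" by (simp add: generates_def)
  qed
  moreover have "\<forall>s\<in>I. X' s \<in> grd M (axis j (int (a s)))"
    using X x_grd by (simp add: X'_def)
  ultimately show ?thesis by blast
qed

text \<open>
  A family of generators with the least sum of orders admits no exchange, so all homogeneous
  relations are termwise zero.  Generators of order \<open>0\<close> are zero and are discarded, because
  intervals must be nonempty.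
\<close>

lemma ex_interval_basis:
  assumes "finitely_generated (Loc (- {j})) M"
  shows "\<exists>(I :: ('a \<times> (int ^ 'm)) set) X a l. interval_basis j M I X a l"
proof -
  from homogeneous_generators[OF assms] obtain I :: "('a \<times> (int ^ 'm)) set" and X0 a where
    fin: "finite I" and X0: "(\<forall>s\<in>I. X0 s \<in> grd M (axis j (int (a s)))) \<and> generates (X0 ` I)"
    by blast
  obtain X where X: "\<And>s. s \<in> I \<Longrightarrow> X s \<in> grd M (axis j (int (a s)))" and gen: "generates (X ` I)"
    and min: "\<And>X'. (\<forall>s\<in>I. X' s \<in> grd M (axis j (int (a s)))) \<and> generates (X' ` I) \<Longrightarrow>
      (\<Sum>s\<in>I. torsion_order (X s)) \<le> (\<Sum>s\<in>I. torsion_order (X' s))"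
    using ex_has_least_nat[of "\<lambda>X. (\<forall>s\<in>I. X s \<in> grd M (axis j (int (a s)))) \<and> generates (X ` I)"
        X0 "\<lambda>X. \<Sum>s\<in>I. torsion_order (X s)", OF X0] by blast
  have Xc: "X ` I \<subseteq> carrier M" using X by auto
  define l where "l = torsion_order \<circ> X"
  define J where "J = {s \<in> I. 0 < l s}"
  have J: "J \<subseteq> I" "finite J" using fin by (auto simp: J_def)
  have XJ: "X s = \<zero>" if "s \<in> I" "s \<notin> J" for s
    using that Xc torsion_order_eq_0[of "X s"] by (auto simp: J_def l_def)
  have restrict: "(\<Oplus>s\<in>I. c s \<odot> X s) = (\<Oplus>s\<in>J. c s \<odot> X s)" if "c \<in> I \<rightarrow> carrier (Loc (- {j}))" for c
    by (rule M.add.finprod_mono_neutral_cong_right)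
      (use fin J XJ that combination_closed[OF that Xc] in \<open>auto dest: funcset_mem\<close>)
  have "\<exists>c\<in>J \<rightarrow> carrier (Loc (- {j})). y = (\<Oplus>s\<in>J. c s \<odot> X s)" if y: "y \<in> carrier M" for y
  proof -
    obtain c where c: "c \<in> I \<rightarrow> carrier (Loc (- {j}))" "y = (\<Oplus>s\<in>I. c s \<odot> X s)"
      using generates_combination[OF fin Xc gen y] by blast
    then have "c \<in> J \<rightarrow> carrier (Loc (- {j}))" using J by auto
    with c restrict show ?thesis by auto
  qed
  moreover have "\<exists>q\<in>carrier (Loc (- {j})). p s = monom j (l s) * q"
    if p: "p \<in> J \<rightarrow> carrier (Loc (- {j}))" and rel: "(\<Oplus>s\<in>J. p s \<odot> X s) = \<zero>" and s: "s \<in> J" for p s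
  proof (rule divisible_by_monom)
    fix f assume f: "f \<in> Poly_Mapping.keys (p s)"
    \<comment> \<open>Minimality is known for the family over \<open>I\<close>, so the relation is extended by zero; then the
      degree is chosen in which the term of exponent \<open>f\<close> of \<open>p s\<close> shows up.\<close>
    define p' where "p' s = (if s \<in> J then p s else 0)" for s
    have p': "p' \<in> I \<rightarrow> carrier (Loc (- {j}))"
      using p by (auto simp: p'_def dest: funcset_mem)
    define d where "d = f + axis j (int (a s))"
    define h where "h s = Poly_Mapping.single (d - axis j (int (a s)))
      (Poly_Mapping.lookup (p' s) (d - axis j (int (a s))))" for s
    have "(\<Oplus>s\<in>I. p' s \<odot> X s) = (\<Oplus>s\<in>J. p' s \<odot> X s)"
      by (rule restrict[OF p'])
    also have "\<dots> = (\<Oplus>s\<in>J. p s \<odot> X s)"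
      using combination_closed[OF p] Xc J
      by (intro M.finsum_cong') (auto simp: p'_def simp del: Pi_iff)
    finally have "component d (\<Oplus>s\<in>I. p' s \<odot> X s) = \<zero>"
      using rel by simp
    then have rel': "(\<Oplus>s\<in>I. h s \<odot> X s) = \<zero>"
      using component_combination[OF X p', where d = d] by (simp add: h_def)
    have h: "h s \<in> grd (Loc (- {j})) (d - axis j (int (a s)))" if "s \<in> I" for s
      using funcset_mem[OF p' that] by (simp add: h_def grd_Loc_iff)
    have "h s \<odot> X s = \<zero>"
    proof (rule ccontr)
      assume nz: "h s \<odot> X s \<noteq> \<zero>"
      have "s \<in> I" using s J by auto
      from improve_generators[OF fin X gen h rel' this nz] min show False
        by (meson leD)
    qed
    then have "Poly_Mapping.single f (Poly_Mapping.lookup (p s) f) \<odot> X s = \<zero>"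
      using s by (simp add: h_def d_def p'_def)
    moreover have "0 \<le> f $ j"
      using funcset_mem[OF p s] f by (auto simp: carrier_Loc_iff)
    moreover have "X s \<in> carrier M" using s J Xc by auto
    ultimately show "int (l s) \<le> f $ j"
      using single_smult_eq_zero_iff[of f "Poly_Mapping.lookup (p s) f" "X s"] f
      by (simp add: l_def in_keys_iff)
  qed
  moreover have "monom j (l s) \<odot> X s = \<zero>" if "s \<in> J" for s
    using that Xc J torsion_order by (auto simp: l_def)
  ultimately have "interval_basis j M J X a l"
    using J X by (auto simp: interval_basis_def J_def)
  then show ?thesis by blast
qed

end

section \<open>Interval objects\<close>

lemma monom_mult_monom: "monom j a * monom j b = monom j (a + b)"
proof -
  have "axis j (int a) + axis j (int b) = axis j (int (a + b))"
    by (simp add: vec_eq_iff axis_def)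
  then show ?thesis by (simp only: monom_def mult_single mult_1)
qed

lemma single_mult_monom_mult:
  "Poly_Mapping.single (- axis j (int a)) 1 * (monom j a * p) = p"
  by (simp add: monom_def mult.assoc[symmetric] mult_single)

lemma monom_mult_left_cancel: "monom j a * p = monom j a * q \<longleftrightarrow> p = q"
proof
  assume "monom j a * p = monom j a * q"
  then have "Poly_Mapping.single (- axis j (int a)) 1 * (monom j a * p) =
      Poly_Mapping.single (- axis j (int a)) 1 * (monom j a * q)"
    by (rule arg_cong)
  then show "p = q" by (simp only: single_mult_monom_mult)
qed simp

lemma monom_mult_grd_iff:
  assumes p: "p \<in> carrier (Loc \<sigma>)"
  shows "monom j a * p \<in> grd (Loc \<sigma>) d \<longleftrightarrow> p \<in> grd (Loc \<sigma>) (d - axis j (int a))"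
proof
  assume *: "monom j a * p \<in> grd (Loc \<sigma>) d"
  then obtain c where "monom j a * p = Poly_Mapping.single d c"
    unfolding grd_Loc_iff by blast
  then have "Poly_Mapping.single (- axis j (int a)) 1 * (monom j a * p) =
      Poly_Mapping.single (- axis j (int a)) 1 * Poly_Mapping.single d c"
    by (rule arg_cong)
  then have "p = Poly_Mapping.single (d - axis j (int a)) c"
    unfolding single_mult_monom_mult mult_single by simp
  then show "p \<in> grd (Loc \<sigma>) (d - axis j (int a))"
    using p by (simp add: grd_Loc_iff)
next
  assume "p \<in> grd (Loc \<sigma>) (d - axis j (int a))"
  then obtain c where "p = Poly_Mapping.single (d - axis j (int a)) c"
    unfolding grd_Loc_iff by blast
  then have "monom j a * p = Poly_Mapping.single d c"
    by (simp add: monom_def mult_single)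
  then show "monom j a * p \<in> grd (Loc \<sigma>) d"
    using Loc_closed(4)[OF monom_in_Loc p, of j a] by (simp add: grd_Loc_iff)
qed

text \<open>
  \<open>monom_multiples j b\<close> is the ideal \<open>t\<^sub>j\<^sup>b R\<^sub>\<sigma>\<close> for \<open>\<sigma> = - {j}\<close>, and the elements of \<open>[a,b)\<^sub>j\<close>
  are its cosets \<open>coset j b q\<close> with \<open>q\<close> in \<open>t\<^sub>j\<^sup>a R\<^sub>\<sigma>\<close>.
\<close>

definition monom_multiples :: "'m \<Rightarrow> nat \<Rightarrow> ('k::field, 'm::finite) laurent set" where
  "monom_multiples j b = (\<lambda>p. monom j b * p) ` carrier (Loc (- {j}))"

definition coset :: "'m \<Rightarrow> nat \<Rightarrow> ('k::field, 'm::finite) laurent \<Rightarrow> ('k, 'm) laurent set" where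
  "coset j b q = (\<lambda>x. x + q) ` monom_multiples j b"

lemma monom_multiples_zero [simp]: "0 \<in> monom_multiples j b"
  unfolding monom_multiples_def by (rule image_eqI[where x = 0]) simp_all

lemma mem_monom_multiples_iff:
  "p \<in> monom_multiples j b \<longleftrightarrow> (\<exists>q\<in>carrier (Loc (- {j})). p = monom j b * q)"
  by (auto simp: monom_multiples_def)

lemma monom_multiples_add:
  assumes "p \<in> monom_multiples j b" "q \<in> monom_multiples j b"
  shows "p + q \<in> monom_multiples j b"
proof -
  from assms obtain p' q' where p': "p' \<in> carrier (Loc (- {j}))" "p = monom j b * p'"
    and q': "q' \<in> carrier (Loc (- {j}))" "q = monom j b * q'"
    by (auto simp: mem_monom_multiples_iff)
  have "p + q = monom j b * (p' + q')" by (simp only: p' q' distrib_left)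
  then show ?thesis
    using Loc_closed(3)[OF p'(1) q'(1)] unfolding mem_monom_multiples_iff by (rule bexI)
qed

lemma monom_multiples_diff:
  assumes "p \<in> monom_multiples j b" "q \<in> monom_multiples j b"
  shows "p - q \<in> monom_multiples j b"
proof -
  from assms obtain p' q' where p': "p' \<in> carrier (Loc (- {j}))" "p = monom j b * p'"
    and q': "q' \<in> carrier (Loc (- {j}))" "q = monom j b * q'"
    by (auto simp: mem_monom_multiples_iff)
  have "p - q = monom j b * (p' - q')" by (simp only: p' q' right_diff_distrib)
  then show ?thesis
    using Loc_closed(6)[OF p'(1) q'(1)] unfolding mem_monom_multiples_iff by (rule bexI)
qed

lemma monom_multiples_mult:
  assumes "r \<in> carrier (Loc (- {j}))" "p \<in> monom_multiples j b"
  shows "r * p \<in> monom_multiples j b"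
proof -
  from assms(2) obtain q where q: "q \<in> carrier (Loc (- {j}))" "p = monom j b * q"
    by (auto simp: mem_monom_multiples_iff)
  then have "r * p = monom j b * (r * q)" by (simp add: mult.left_commute)
  then show ?thesis using Loc_closed(4)[OF assms(1) q(1)] by (simp add: monom_multiples_def)
qed

lemma mem_coset_iff: "x \<in> coset j b q \<longleftrightarrow> x - q \<in> monom_multiples j b"
proof
  assume "x - q \<in> monom_multiples j b"
  then show "x \<in> coset j b q"
    unfolding coset_def by (intro image_eqI[where x = "x - q"]) simp_all
qed (auto simp: coset_def)

lemma coset_eq_iff: "coset j b q = coset j b q' \<longleftrightarrow> q - q' \<in> monom_multiples j b"
proof
  assume "coset j b q = coset j b q'"
  then have "q \<in> coset j b q'" using mem_coset_iff[of q j b q] by simp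
  then show "q - q' \<in> monom_multiples j b" by (simp add: mem_coset_iff)
next
  assume *: "q - q' \<in> monom_multiples j b"
  have "x - q \<in> monom_multiples j b \<longleftrightarrow> x - q' \<in> monom_multiples j b" for x
    using monom_multiples_add[OF _ *, of "x - q"] monom_multiples_diff[OF _ *, of "x - q'"] by auto
  then show "coset j b q = coset j b q'" by (auto simp: mem_coset_iff)
qed

lemma coset_add: "(\<Union>x\<in>coset j b q. \<Union>y\<in>coset j b q'. {x + y}) = coset j b (q + q')"
proof (intro equalityI subsetI)
  fix z assume "z \<in> (\<Union>x\<in>coset j b q. \<Union>y\<in>coset j b q'. {x + y})"
  then obtain x y where "x - q \<in> monom_multiples j b" "y - q' \<in> monom_multiples j b" "z = x + y"
    by (auto simp: mem_coset_iff)
  then show "z \<in> coset j b (q + q')"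
    using monom_multiples_add[of "x - q" j b "y - q'"] by (simp add: mem_coset_iff algebra_simps)
next
  fix z assume "z \<in> coset j b (q + q')"
  then have "z - q' \<in> coset j b q" "q' \<in> coset j b q'" "z = (z - q') + q'"
    by (simp_all add: mem_coset_iff algebra_simps)
  then show "z \<in> (\<Union>x\<in>coset j b q. \<Union>y\<in>coset j b q'. {x + y})" by blast
qed

lemma coset_smult:
  assumes r: "r \<in> carrier (Loc (- {j}))"
  shows "(\<Union>x\<in>coset j b q. coset j b (r * x)) = coset j b (r * q)"
proof -
  have "coset j b (r * x) = coset j b (r * q)" if "x \<in> coset j b q" for x
    using monom_multiples_mult[OF r, of "x - q"] that
    by (simp add: coset_eq_iff mem_coset_iff right_diff_distrib)
  moreover have "q \<in> coset j b q" by (simp add: mem_coset_iff)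
  ultimately show ?thesis by blast
qed

lemma interval_other:
  "\<sigma> \<noteq> - {i} \<Longrightarrow> val (interval i a b) \<sigma> = gmod_zero {0}"
  by (simp add: interval_def)

lemma interval_facet:
  fixes j :: "'m::finite" and a b :: nat
  defines "N \<equiv> (val (interval j a b) (- {j}) :: (('k::field, 'm) laurent, _, _) gmodule)"
  shows "carrier N = coset j b ` monom_multiples j a"
    "\<zero>\<^bsub>N\<^esub> = coset j b 0"
    "coset j b q \<oplus>\<^bsub>N\<^esub> coset j b q' = coset j b (q + q')"
    "r \<in> carrier (Loc (- {j})) \<Longrightarrow> r \<odot>\<^bsub>N\<^esub> coset j b q = coset j b (r * q)"
    "grd N d = coset j b ` (grd (Loc (- {j})) d \<inter> monom_multiples j a)"
proof -
  have rcoset: "carrier (monom_ideal (- {j}) j b) +>\<^bsub>monom_ideal (- {j}) j a\<^esub> q = coset j b q" for q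
    by (auto simp: a_r_coset_def r_coset_def monom_ideal_def coset_def monom_multiples_def Loc_def)
  show "carrier N = coset j b ` monom_multiples j a"
    unfolding N_def interval_def gmod_quot_def
    by (auto simp: A_RCOSETS_def' rcoset) (auto simp: monom_ideal_def monom_multiples_def)
  show "\<zero>\<^bsub>N\<^esub> = coset j b 0"
    by (simp add: N_def interval_def gmod_quot_def coset_def monom_ideal_def monom_multiples_def)
  show "coset j b q \<oplus>\<^bsub>N\<^esub> coset j b q' = coset j b (q + q')"
    using coset_add[where q = q and q' = q']
    by (simp add: N_def interval_def gmod_quot_def set_add_def' monom_ideal_def)
  show "r \<odot>\<^bsub>N\<^esub> coset j b q = coset j b (r * q)" if "r \<in> carrier (Loc (- {j}))"
    using coset_smult[OF that, of b q]
    by (simp add: N_def interval_def gmod_quot_def rcoset) (simp add: monom_ideal_def Loc_def)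
  show "grd N d = coset j b ` (grd (Loc (- {j})) d \<inter> monom_multiples j a)"
    by (simp add: N_def interval_def gmod_quot_def rcoset) (simp add: monom_ideal_def monom_multiples_def)
qed

section \<open>From a basis to an isomorphism\<close>

lemma (in graded_Loc_module) gmod_iso_if_bij:
  assumes f: "f \<in> gmod_hom (Loc \<sigma>) M N" and bij: "bij_betw f (carrier M) (carrier N)"
    and graded: "\<And>d. grd N d \<subseteq> f ` grd M d"
  shows "f \<in> gmod_iso (Loc \<sigma>) M N"
proof -
  define g where "g = inv_into (carrier M) f"
  have gf: "g (f x) = x" if "x \<in> carrier M" for x
    using bij that by (simp add: g_def bij_betw_inv_into_left)
  have surj: "carrier N = f ` carrier M"
    using bij by (simp add: bij_betw_def)
  have hom: "f (x \<oplus> y) = f x \<oplus>\<^bsub>N\<^esub> f y" "r \<in> carrier (Loc \<sigma>) \<Longrightarrow> f (r \<odot> x) = r \<odot>\<^bsub>N\<^esub> f x"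
    if "x \<in> carrier M" "y \<in> carrier M" for x y r
    using f that by (auto simp: gmod_hom_def)
  have "g \<in> gmod_hom (Loc \<sigma>) N M"
    unfolding gmod_hom_def
  proof (intro CollectI conjI ballI allI)
    show "g \<in> carrier N \<rightarrow> carrier M" by (auto simp: surj gf)
    show "g (u \<oplus>\<^bsub>N\<^esub> v) = g u \<oplus> g v" if "u \<in> carrier N" "v \<in> carrier N" for u v
      using that by (auto simp: surj gf simp flip: hom(1))
    show "g (r \<odot>\<^bsub>N\<^esub> u) = r \<odot> g u" if "r \<in> carrier (Loc \<sigma>)" "u \<in> carrier N" for r u
      using that by (auto simp: surj gf simp flip: hom(2))
    show "g ` grd N d \<subseteq> grd M d" for d
      using graded[of d] by (fastforce simp: gf)
  qed
  moreover have "\<forall>x\<in>carrier M. g (f x) = x" "\<forall>y\<in>carrier N. f (g y) = y"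
    by (auto simp: gf surj)
  ultimately show ?thesis
    using f by (auto simp: gmod_iso_def)
qed

text \<open>
  Two modules with maps \<open>S\<close> and \<open>F\<close> onto them from the same set \<open>C\<close>, both compatible with the
  operations and with the same fibres, are isomorphic.  Homogeneous parts correspond when they are
  images of the same subsets \<open>D d\<close> of \<open>C\<close>.  This form avoids giving either direction of the
  isomorphism by a formula: neither module has canonical representatives.
\<close>

lemma (in graded_Loc_module) gmod_iso_if_common_presentation:
  assumes S: "S ` C = carrier M" and F: "F ` C = carrier N"
    and eq: "\<And>c c'. c \<in> C \<Longrightarrow> c' \<in> C \<Longrightarrow> S c = S c' \<longleftrightarrow> F c = F c'"
    and add: "\<And>c c'. c \<in> C \<Longrightarrow> c' \<in> C \<Longrightarrow>
      \<exists>c''\<in>C. S c'' = S c \<oplus> S c' \<and> F c'' = F c \<oplus>\<^bsub>N\<^esub> F c'"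
    and smult: "\<And>r c. r \<in> carrier (Loc \<sigma>) \<Longrightarrow> c \<in> C \<Longrightarrow>
      \<exists>c'\<in>C. S c' = r \<odot> S c \<and> F c' = r \<odot>\<^bsub>N\<^esub> F c"
    and grd_S: "\<And>d. grd M d = S ` D d" and grd_F: "\<And>d. grd N d = F ` D d"
    and D: "\<And>d. D d \<subseteq> C"
  shows "\<exists>f. f \<in> gmod_iso (Loc \<sigma>) M N"
proof
  define f where "f x = F (SOME c. c \<in> C \<and> S c = x)" for x
  have f: "f (S c) = F c" if "c \<in> C" for c
    unfolding f_def by (rule someI2[of _ c]) (use that eq in auto)
  have f_grd: "f ` grd M d = grd N d" for d
    unfolding grd_S grd_F image_image using D f by (intro image_cong) auto
  show "f \<in> gmod_iso (Loc \<sigma>) M N"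
  proof (rule gmod_iso_if_bij)
    show "f \<in> gmod_hom (Loc \<sigma>) M N"
      unfolding gmod_hom_def
    proof (intro CollectI conjI ballI allI)
      show "f \<in> carrier M \<rightarrow> carrier N"
        using F by (auto simp: f simp flip: S)
      show "f (x \<oplus> y) = f x \<oplus>\<^bsub>N\<^esub> f y" if xy: "x \<in> carrier M" "y \<in> carrier M" for x y
      proof -
        from xy obtain c c' where c: "c \<in> C" "x = S c" "c' \<in> C" "y = S c'"
          by (auto simp flip: S)
        with add obtain c'' where "c'' \<in> C" "S c'' = S c \<oplus> S c'" "F c'' = F c \<oplus>\<^bsub>N\<^esub> F c'"
          by blast
        with c f[of c''] show ?thesis by (simp add: f)
      qed
      show "f (r \<odot> x) = r \<odot>\<^bsub>N\<^esub> f x" if rx: "r \<in> carrier (Loc \<sigma>)" "x \<in> carrier M" for r x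
      proof -
        from rx obtain c where c: "c \<in> C" "x = S c"
          by (auto simp flip: S)
        with smult[OF rx(1)] obtain c' where "c' \<in> C" "S c' = r \<odot> S c" "F c' = r \<odot>\<^bsub>N\<^esub> F c"
          by blast
        with c f[of c'] show ?thesis by (simp add: f)
      qed
      show "f ` grd M d \<subseteq> grd N d" for d by (simp add: f_grd)
    qed
    show "bij_betw f (carrier M) (carrier N)"
      unfolding bij_betw_def
    proof
      show "inj_on f (carrier M)"
        unfolding inj_on_def S[symmetric] using eq by (auto simp: f)
      show "f ` carrier M = carrier N"
        unfolding S[symmetric] F[symmetric] image_image using f by (intro image_cong) auto
    qed
    show "grd N d \<subseteq> f ` grd M d" for d by (simp add: f_grd)
  qed
qed

lemma (in graded_Loc_module) interval_basis_reindex: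
  assumes basis: "interval_basis j M I X a l" and h: "bij_betw h J I" and \<sigma>: "\<sigma> = - {j}"
  shows "interval_basis j M J (X \<circ> h) (a \<circ> h) (l \<circ> h)"
proof -
  have I: "h ` J = I" and inj: "inj_on h J" using h by (auto simp: bij_betw_def)
  have X: "X ` I \<subseteq> carrier M" using basis by (auto simp: interval_basis_def)
  have sum: "(\<Oplus>s\<in>I. c s \<odot> X s) = (\<Oplus>s\<in>J. c (h s) \<odot> X (h s))" if "c \<in> I \<rightarrow> carrier (Loc \<sigma>)" for c
    using M.finsum_reindex[of "\<lambda>s. c s \<odot> X s" h J] combination_closed[OF that X] inj by (simp add: I)
  have "\<exists>c\<in>J \<rightarrow> carrier (Loc \<sigma>). y = (\<Oplus>s\<in>J. c s \<odot> X (h s))" if y: "y \<in> carrier M" for y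
  proof -
    obtain c where c: "c \<in> I \<rightarrow> carrier (Loc \<sigma>)" "y = (\<Oplus>s\<in>I. c s \<odot> X s)"
      using basis y unfolding interval_basis_def \<sigma> by blast
    moreover have "(\<lambda>s. c (h s)) \<in> J \<rightarrow> carrier (Loc \<sigma>)" using c(1) I by auto
    ultimately show ?thesis using sum[OF c(1)] by (intro bexI[of _ "\<lambda>s. c (h s)"]) simp_all
  qed
  moreover have "\<exists>q\<in>carrier (Loc \<sigma>). p s = monom j (l (h s)) * q"
    if p: "p \<in> J \<rightarrow> carrier (Loc \<sigma>)" and rel: "(\<Oplus>s\<in>J. p s \<odot> X (h s)) = \<zero>" and s: "s \<in> J" for p s
  proof -
    define p' where "p' = p \<circ> inv_into J h"
    have p'h: "p' (h s) = p s" if "s \<in> J" for s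
      using inj that by (simp add: p'_def)
    have p': "p' \<in> I \<rightarrow> carrier (Loc \<sigma>)"
      using p p'h by (auto simp flip: I)
    have "(\<Oplus>s\<in>I. p' s \<odot> X s) = (\<Oplus>s\<in>J. p' (h s) \<odot> X (h s))"
      by (rule sum[OF p'])
    also have "\<dots> = (\<Oplus>s\<in>J. p s \<odot> X (h s))"
      using X I combination_closed[of p J "\<lambda>s. X (h s)"] p
      by (intro M.finsum_cong') (auto simp: p'h)
    finally have "\<exists>q\<in>carrier (Loc \<sigma>). p' (h s) = monom j (l (h s)) * q"
      using basis rel p' s I unfolding interval_basis_def \<sigma> by auto
    then show ?thesis using p'h s by simp
  qed
  moreover have "finite J" using h basis bij_betw_finite by (auto simp: interval_basis_def)
  ultimately show ?thesis
    using basis I unfolding interval_basis_def \<sigma> by auto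
qed

text \<open>
  At the facet \<open>- {j}\<close> the summands with \<open>i s \<noteq> j\<close> contribute the zero module \<open>{{0}}\<close>, so elements
  of the sum are families of cosets on the other indices.  \<open>F\<close> is the projection from the free
  module on these indices, sending the \<open>s\<close>-th basis vector to the generator \<open>t\<^sub>j\<^bsup>a s\<^esup>\<close> of
  \<open>[a s, b s)\<^sub>j\<close>.
\<close>

lemma L_sum_facet:
  fixes n :: nat and i :: "nat \<Rightarrow> 'm::finite" and a b :: "nat \<Rightarrow> nat" and j :: 'm
  defines "N \<equiv> (val (L_sum {..<n} (\<lambda>s. interval (i s) (a s) (b s))) (- {j}) ::
    (('k::field, 'm) laurent, _, _) gmodule)"
  defines "F \<equiv> \<lambda>c :: nat \<Rightarrow> ('k, 'm) laurent.
    \<lambda>s\<in>{..<n}. if i s = j then coset j (b s) (monom j (a s) * c s) else {0}"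
  shows "carrier N =
      (\<Pi>\<^sub>E s\<in>{..<n}. if i s = j then coset j (b s) ` monom_multiples j (a s) else {{0}})"
    "grd N d = (\<Pi>\<^sub>E s\<in>{..<n}.
      if i s = j then coset j (b s) ` (grd (Loc (- {j})) d \<inter> monom_multiples j (a s)) else {{0}})"
    "F c \<oplus>\<^bsub>N\<^esub> F c' = F (\<lambda>s. c s + c' s)"
    "r \<in> carrier (Loc (- {j})) \<Longrightarrow> r \<odot>\<^bsub>N\<^esub> F c = F (\<lambda>s. r * c s)"
proof -
  let ?v = "\<lambda>s. val (interval (i s) (a s) (b s)) (- {j}) :: (('k, 'm) laurent, _, _) gmodule"
  have carrier_v: "carrier (?v s) = (if i s = j then coset j (b s) ` monom_multiples j (a s) else {{0}})" for s
    by (cases "i s = j") (simp_all add: interval_facet interval_other gmod_zero_def)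
  have grd_v: "grd (?v s) d = (if i s = j
      then coset j (b s) ` (grd (Loc (- {j})) d \<inter> monom_multiples j (a s)) else {{0}})" for s
    by (cases "i s = j") (simp_all add: interval_facet interval_other gmod_zero_def)
  show "carrier N = (\<Pi>\<^sub>E s\<in>{..<n}. if i s = j then coset j (b s) ` monom_multiples j (a s) else {{0}})"
    by (simp add: N_def L_sum_def gmod_sum_def carrier_v)
  show "grd N d = (\<Pi>\<^sub>E s\<in>{..<n}.
      if i s = j then coset j (b s) ` (grd (Loc (- {j})) d \<inter> monom_multiples j (a s)) else {{0}})"
    by (simp add: N_def L_sum_def gmod_sum_def grd_v)
  show "F c \<oplus>\<^bsub>N\<^esub> F c' = F (\<lambda>s. c s + c' s)"
  proof
    fix s
    have "F c s \<oplus>\<^bsub>?v s\<^esub> F c' s = F (\<lambda>s. c s + c' s) s" if "s < n"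
      using that by (cases "i s = j")
        (simp_all add: F_def interval_facet interval_other gmod_zero_def distrib_left)
    then show "(F c \<oplus>\<^bsub>N\<^esub> F c') s = F (\<lambda>s. c s + c' s) s"
      by (cases "s < n") (simp_all add: N_def L_sum_def gmod_sum_def, simp add: F_def)
  qed
  show "r \<odot>\<^bsub>N\<^esub> F c = F (\<lambda>s. r * c s)" if r: "r \<in> carrier (Loc (- {j}))"
  proof
    fix s
    have "r \<odot>\<^bsub>?v s\<^esub> F c s = F (\<lambda>s. r * c s) s" if "s < n"
      using that r by (cases "i s = j")
        (simp_all add: F_def interval_facet interval_other gmod_zero_def mult.left_commute)
    then show "(r \<odot>\<^bsub>N\<^esub> F c) s = F (\<lambda>s. r * c s) s"
      by (cases "s < n") (simp_all add: N_def L_sum_def gmod_sum_def, simp add: F_def)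
  qed
qed

context torsion_facet_module
begin

text \<open>
  Both modules are quotients of the coefficient families on \<open>J\<close>: \<open>S\<close> forms the combination of
  the basis elements, \<open>F\<close> the family of cosets.  By the defining property of an interval basis,
  the kernel of \<open>S\<close> consists of the families with \<open>c s\<close> in \<open>t\<^sub>j\<^bsup>l s\<^esup> R\<^sub>\<sigma>\<close>, and multiplying by
  \<open>t\<^sub>j\<^bsup>a s\<^esup>\<close> shows that this is the kernel of \<open>F\<close>.
\<close>

lemma sum_of_intervals_iso:
  fixes n :: nat and i :: "nat \<Rightarrow> 'm" and a b l :: "nat \<Rightarrow> nat"
  defines "J \<equiv> {s. s < n \<and> i s = j}"
    and "N \<equiv> (val (L_sum {..<n} (\<lambda>s. interval (i s) (a s) (b s))) (- {j}) :: (('k, 'm) laurent, _, _) gmodule)"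
  assumes basis: "interval_basis j M J X a l" and b: "\<And>s. s \<in> J \<Longrightarrow> b s = a s + l s"
  shows "\<exists>f. f \<in> gmod_iso (Loc (- {j})) M N"
proof -
  let ?R = "carrier (Loc (- {j})) :: ('k, 'm) laurent set"
  define S where "S c = (\<Oplus>s\<in>J. c s \<odot> X s)" for c
  define F where "F c = (\<lambda>s\<in>{..<n}. if i s = j then coset j (b s) (monom j (a s) * c s) else {0})"
    for c :: "nat \<Rightarrow> ('k, 'm) laurent"
  define D where "D d = {c \<in> J \<rightarrow> ?R. \<forall>s\<in>J. c s \<in> grd (Loc (- {j})) (d - axis j (int (a s)))}" for d
  have fin: "finite J" and X: "X ` J \<subseteq> carrier M"
    and X_grd: "\<And>s. s \<in> J \<Longrightarrow> X s \<in> grd M (axis j (int (a s)))"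
    and X_order: "\<And>s. s \<in> J \<Longrightarrow> monom j (l s) \<odot> X s = \<zero>"
    and gen: "\<And>y. y \<in> carrier M \<Longrightarrow> \<exists>c\<in>J \<rightarrow> ?R. y = S c"
    and indep: "\<And>p s. p \<in> J \<rightarrow> ?R \<Longrightarrow> S p = \<zero> \<Longrightarrow> s \<in> J \<Longrightarrow> \<exists>q\<in>?R. p s = monom j (l s) * q"
    using basis unfolding interval_basis_def S_def by auto
  have S_closed: "S c \<in> carrier M" if "c \<in> J \<rightarrow> ?R" for c
    using combination_closed[OF that X] by (simp add: S_def)
  have S_add: "S c \<oplus> S c' = S (\<lambda>s. c s + c' s)" if "c \<in> J \<rightarrow> ?R" "c' \<in> J \<rightarrow> ?R" for c c'
    unfolding S_def by (rule combination_add[OF X that])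
  have S_smult: "r \<odot> S c = S (\<lambda>s. r * c s)" if "r \<in> ?R" "c \<in> J \<rightarrow> ?R" for r c
    unfolding S_def by (rule combination_smult[OF fin X that])
  note N = L_sum_facet[where ?'k = 'k and n = n and i = i and a = a and b = b and j = j,
      folded N_def F_def]
  have S_0: "S c = \<zero> \<longleftrightarrow> (\<forall>s\<in>J. monom j (a s) * c s \<in> monom_multiples j (b s))" if c: "c \<in> J \<rightarrow> ?R" for c
  proof
    assume 0: "S c = \<zero>"
    show "\<forall>s\<in>J. monom j (a s) * c s \<in> monom_multiples j (b s)"
    proof
      fix s assume s: "s \<in> J"
      from indep[OF c 0 s] obtain q where q: "q \<in> ?R" "c s = monom j (l s) * q" by blast
      have "monom j (a s) * c s = monom j (b s) * q"
        by (simp only: q b[OF s] monom_mult_monom[symmetric] mult.assoc)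
      then show "monom j (a s) * c s \<in> monom_multiples j (b s)"
        using q by (simp add: monom_multiples_def)
    qed
  next
    assume *: "\<forall>s\<in>J. monom j (a s) * c s \<in> monom_multiples j (b s)"
    have "c s \<odot> X s = \<zero>" if s: "s \<in> J" for s
    proof -
      from * s obtain q where q: "q \<in> ?R" "monom j (a s) * c s = monom j (b s) * q"
        by (auto simp: monom_multiples_def)
      have "monom j (a s) * c s = monom j (a s) * (monom j (l s) * q)"
        by (simp only: q b[OF s] monom_mult_monom[symmetric] mult.assoc)
      then have "c s = q * monom j (l s)"
        by (simp only: monom_mult_left_cancel mult.commute[of q])
      then show ?thesis
        using q s X X_order[OF s] by (simp add: smult_mult image_subset_iff)
    qed
    then show "S c = \<zero>" unfolding S_def by (rule M.add.finprod_one_eqI)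
  qed
  have F_eqI: "u = F c"
    if u: "u \<in> (\<Pi>\<^sub>E s\<in>{..<n}. if i s = j then A s else {{0}})"
      and c: "\<forall>s\<in>J. u s = coset j (b s) (monom j (a s) * c s)" for u A c
  proof
    fix s
    show "u s = F c s"
    proof (cases "s < n")
      case True
      then show ?thesis using PiE_mem[OF u, of s] c by (cases "i s = j") (simp_all add: F_def J_def)
    next
      case False
      then show ?thesis using PiE_arb[OF u, of s] by (simp add: F_def)
    qed
  qed
  show ?thesis
  proof (rule gmod_iso_if_common_presentation[where S = S and F = F and C = "J \<rightarrow> ?R" and D = D])
    show "S ` (J \<rightarrow> ?R) = carrier M" using gen S_closed by blast
    show "S c = S c' \<longleftrightarrow> F c = F c'" if c: "c \<in> J \<rightarrow> ?R" "c' \<in> J \<rightarrow> ?R" for c c'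
    proof -
      have cc: "(\<lambda>s. c s - c' s) \<in> J \<rightarrow> ?R" using c by (simp add: Pi_iff)
      have "S c = S (\<lambda>s. c s - c' s) \<oplus> S c'"
        using S_add[OF cc c(2)] by simp
      then have "S c = S c' \<longleftrightarrow> S (\<lambda>s. c s - c' s) = \<zero>"
        using S_closed[OF cc] S_closed[OF c(2)] by (metis M.add.r_cancel_one)
      also have "\<dots> \<longleftrightarrow> (\<forall>s\<in>J. coset j (b s) (monom j (a s) * c s) = coset j (b s) (monom j (a s) * c' s))"
        by (simp add: S_0[OF cc] coset_eq_iff right_diff_distrib)
      also have "\<dots> \<longleftrightarrow> F c = F c'"
        by (auto simp: F_def J_def fun_eq_iff restrict_def)
      finally show ?thesis .
    qed
    show "\<exists>c''\<in>J \<rightarrow> ?R. S c'' = S c \<oplus> S c' \<and> F c'' = F c \<oplus>\<^bsub>N\<^esub> F c'"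
      if c: "c \<in> J \<rightarrow> ?R" "c' \<in> J \<rightarrow> ?R" for c c'
      by (rule bexI[OF _ Pi_add_closed[OF c]]) (simp add: S_add[OF c] N(3))
    show "\<exists>c'\<in>J \<rightarrow> ?R. S c' = r \<odot> S c \<and> F c' = r \<odot>\<^bsub>N\<^esub> F c"
      if r: "r \<in> ?R" and c: "c \<in> J \<rightarrow> ?R" for r c
      by (rule bexI[OF _ Pi_mult_closed[OF r c]]) (simp add: S_smult[OF r c] N(4)[OF r])
    show "D d \<subseteq> J \<rightarrow> ?R" for d by (auto simp: D_def)
    show "grd M d = S ` D d" for d
    proof (intro equalityI subsetI)
      fix x assume x: "x \<in> grd M d"
      then obtain c where c: "c \<in> J \<rightarrow> ?R" "x = S c" using gen by blast
      have "x = component d x" using component_homogeneous[OF x, of d] by simp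
      also have "\<dots> = S (\<lambda>s. Poly_Mapping.single (d - axis j (int (a s)))
          (Poly_Mapping.lookup (c s) (d - axis j (int (a s)))))" (is "_ = S ?c")
        unfolding c(2) unfolding S_def by (rule component_combination[OF X_grd c(1)])
      finally have "x = S ?c" .
      moreover have "?c \<in> D d"
        using c(1) by (simp add: D_def Pi_iff grd_Loc_iff)
      ultimately show "x \<in> S ` D d" by blast
    next
      fix x assume "x \<in> S ` D d"
      then obtain c where c: "c \<in> D d" "x = S c" by blast
      have "c s \<odot> X s \<in> grd M d" if "s \<in> J" for s
        using grd_smult[OF _ X_grd[OF that], of "c s" "d - axis j (int (a s))"] c(1) that by (simp add: D_def)
      then show "x \<in> grd M d" unfolding c(2) S_def by (rule grd_finsum)
    qed
    show "F ` (J \<rightarrow> ?R) = carrier N"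
    proof (intro equalityI subsetI)
      fix u assume "u \<in> F ` (J \<rightarrow> ?R)"
      then show "u \<in> carrier N"
        unfolding N by (auto simp: F_def J_def monom_multiples_def PiE_iff Pi_iff)
    next
      fix u assume u: "u \<in> carrier N"
      have "\<exists>c\<in>?R. u s = coset j (b s) (monom j (a s) * c)" if "s \<in> J" for s
        using PiE_mem[OF u[unfolded N], of s] that by (auto simp: J_def monom_multiples_def)
      then obtain c where c: "\<forall>s\<in>J. c s \<in> ?R \<and> u s = coset j (b s) (monom j (a s) * c s)"
        by metis
      have "u = F c"
        using c by (intro F_eqI[OF u[unfolded N]]) blast
      then show "u \<in> F ` (J \<rightarrow> ?R)" using c by blast
    qed
    show "grd N d = F ` D d" for d
    proof (intro equalityI subsetI)
      fix u assume "u \<in> F ` D d"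
      then obtain c where c: "c \<in> D d" "u = F c" by blast
      have "monom j (a s) * c s \<in> grd (Loc (- {j})) d \<inter> monom_multiples j (a s)" if s: "s \<in> J" for s
      proof -
        have c_grd: "c s \<in> grd (Loc (- {j})) (d - axis j (int (a s)))" and c_R: "c s \<in> ?R"
          using c(1) s by (auto simp: D_def)
        show ?thesis
          using monom_mult_grd_iff[OF c_R] c_grd c_R by (auto simp: monom_multiples_def)
      qed
      then show "u \<in> grd N d"
        unfolding N c(2) by (auto simp: F_def J_def PiE_iff)
    next
      fix u assume u: "u \<in> grd N d"
      have "\<forall>s\<in>J. \<exists>c\<in>grd (Loc (- {j})) (d - axis j (int (a s))). u s = coset j (b s) (monom j (a s) * c)"
      proof
        fix s assume "s \<in> J"
        then obtain p where p: "p \<in> ?R" "monom j (a s) * p \<in> grd (Loc (- {j})) d"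
          "u s = coset j (b s) (monom j (a s) * p)"
          using PiE_mem[OF u[unfolded N], of s] by (auto simp: J_def monom_multiples_def)
        then show "\<exists>c\<in>grd (Loc (- {j})) (d - axis j (int (a s))). u s = coset j (b s) (monom j (a s) * c)"
          using monom_mult_grd_iff[OF p(1)] by blast
      qed
      then obtain c where c: "\<forall>s\<in>J. c s \<in> grd (Loc (- {j})) (d - axis j (int (a s))) \<and>
          u s = coset j (b s) (monom j (a s) * c s)"
        by metis
      have "u = F c"
        using c by (intro F_eqI[OF u[unfolded N]]) blast
      moreover have "c \<in> D d" using c by (auto simp: D_def grd_Loc_iff)
      ultimately show "u \<in> F ` D d" by blast
    qed
  qed
qed

end

section \<open>Torsion objects\<close>

text \<open>
  If \<open>t\<^sub>i\<^sup>n x = 0\<close> then \<open>t\<^sub>i\<^sup>n\<close> kills \<open>\<phi>\<^sub>i(x)\<close>, on which it acts invertibly.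
\<close>

lemma torsion_structure_map_zero:
  fixes M :: "('k::field, 'm::finite, 'a) Lobj"
  assumes M: "torsion_object M" and x: "x \<in> carrier (val M (- {i}))"
  shows "str M i x = \<zero>\<^bsub>val M UNIV\<^esub>"
proof -
  have L: "L_object M" using M by (simp add: torsion_object_def)
  have notK: "- {i} \<notin> K" "(UNIV :: 'm set) \<notin> K" by (auto simp: not_in_K_iff)
  interpret N: graded_Loc_module UNIV "val M UNIV"
    using L notK by unfold_locales (simp add: L_object_def)
  interpret P: graded_Loc_module "- {i}" "val M (- {i})"
    using L notK by unfold_locales (simp add: L_object_def)
  have hom: "str M i x \<in> carrier (val M UNIV)" "r \<in> carrier (Loc (- {i})) \<Longrightarrow>
      str M i (r \<odot>\<^bsub>val M (- {i})\<^esub> x) = r \<odot>\<^bsub>val M UNIV\<^esub> str M i x" for r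
    using L x by (auto simp: L_object_def gmod_hom_def)
  obtain n where "monom i n \<odot>\<^bsub>val M (- {i})\<^esub> x = 0 \<odot>\<^bsub>val M (- {i})\<^esub> x"
    using M x by (auto simp: torsion_object_def)
  then have "monom i n \<odot>\<^bsub>val M UNIV\<^esub> str M i x = \<zero>\<^bsub>val M UNIV\<^esub>"
    using hom(2)[of "monom i n"] hom(2)[of 0] hom(1) by simp
  moreover have u: "(Poly_Mapping.single (- axis i (int n)) 1 :: ('k, 'm) laurent) \<in> carrier (Loc UNIV)"
    by (simp add: degrees_def)
  ultimately have "(Poly_Mapping.single (- axis i (int n)) 1 * monom i n) \<odot>\<^bsub>val M UNIV\<^esub> str M i x
      = \<zero>\<^bsub>val M UNIV\<^esub>"
    unfolding N.smult_mult[OF u monom_in_Loc hom(1)] using u by simp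
  then show ?thesis
    using single_mult_monom_mult[of i n "1 :: ('k, 'm) laurent"] hom(1) by simp
qed

lemma tensor_cosetE:
  assumes "X \<in> carrier (tensor S R P)"
  obtains z where "z \<in> carrier (free_Abelian_group (carrier S \<times> carrier P))"
    "X = (\<Union>r\<in>tensor_relations S R P. {r + z})"
  using assms
  by (auto simp: tensor_def gmod_quot_def A_RCOSETS_def' a_r_coset_def r_coset_def tensor_free_def)

lemma tensor_coset_nonempty:
  assumes "X \<in> carrier (tensor S R P)" shows "X \<noteq> {}"
proof -
  obtain z where "X = (\<Union>r\<in>tensor_relations S R P. {r + z})"
    using tensor_cosetE[OF assms] .
  moreover have "\<one>\<^bsub>free_Abelian_group (carrier S \<times> carrier P)\<^esub> \<in> tensor_relations S R P"
    unfolding tensor_relations_def by (rule generate.one)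
  ultimately show ?thesis by blast
qed

text \<open>
  The evaluation \<open>tensor_induced\<close> of a coset inspects each of its representatives, so one has to know
  that none of them involves symbols outside \<open>S \<times> P\<close>, where the structure map is uncontrolled.
\<close>

lemma tensor_coset_keys:
  assumes S: "cring S" and P: "module R P" and R: "carrier R \<subseteq> carrier S"
    and X: "X \<in> carrier (tensor S R P)" and c: "c \<in> X"
  shows "Poly_Mapping.keys c \<subseteq> carrier S \<times> carrier P"
proof -
  interpret S: cring S by (rule S)
  interpret P: module R P by (rule P)
  let ?G = "free_Abelian_group (carrier S \<times> carrier P)"
  have frag: "frag_of (s, x) \<in> carrier ?G" if "s \<in> carrier S" "x \<in> carrier P" for s x
    using that by (simp add: free_Abelian_group_def)
  have diff: "a - b \<in> carrier ?G" if "a \<in> carrier ?G" "b \<in> carrier ?G" for a b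
    using that keys_diff[of a b] by (auto simp: free_Abelian_group_def)
  have "tensor_relations S R P \<subseteq> carrier ?G"
    unfolding tensor_relations_def
  proof (rule group.generate_incl[OF group_free_Abelian_group], intro Un_least subsetI)
    fix c assume "c \<in> {frag_of (s \<oplus>\<^bsub>S\<^esub> s', x) - frag_of (s, x) - frag_of (s', x) | s s' x.
      s \<in> carrier S \<and> s' \<in> carrier S \<and> x \<in> carrier P}"
    then obtain s s' x where "c = frag_of (s \<oplus>\<^bsub>S\<^esub> s', x) - frag_of (s, x) - frag_of (s', x)"
      and "s \<in> carrier S" "s' \<in> carrier S" "x \<in> carrier P"
      by blast
    then show "c \<in> carrier ?G"
      by (simp only:) (intro diff frag S.add.m_closed)
  next
    fix c assume "c \<in> {frag_of (s, x \<oplus>\<^bsub>P\<^esub> y) - frag_of (s, x) - frag_of (s, y) | s x y.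
      s \<in> carrier S \<and> x \<in> carrier P \<and> y \<in> carrier P}"
    then obtain s x y where "c = frag_of (s, x \<oplus>\<^bsub>P\<^esub> y) - frag_of (s, x) - frag_of (s, y)"
      and "s \<in> carrier S" "x \<in> carrier P" "y \<in> carrier P"
      by blast
    then show "c \<in> carrier ?G"
      by (simp only:) (intro diff frag P.M.add.m_closed)
  next
    fix c assume "c \<in> {frag_of (s \<otimes>\<^bsub>S\<^esub> r, x) - frag_of (s, r \<odot>\<^bsub>P\<^esub> x) | s r x.
      s \<in> carrier S \<and> r \<in> carrier R \<and> x \<in> carrier P}"
    then obtain s r x where "c = frag_of (s \<otimes>\<^bsub>S\<^esub> r, x) - frag_of (s, r \<odot>\<^bsub>P\<^esub> x)"
      and "s \<in> carrier S" "r \<in> carrier R" "x \<in> carrier P"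
      by blast
    moreover from this R have "r \<in> carrier S" by blast
    ultimately show "c \<in> carrier ?G"
      by (simp only:) (intro diff frag S.m_closed P.smult_closed)
  qed
  moreover obtain z where z: "z \<in> carrier ?G" "X = (\<Union>r\<in>tensor_relations S R P. {r + z})"
    using tensor_cosetE[OF X] .
  moreover from z(2) c obtain r where "r \<in> tensor_relations S R P" "c = r + z" by blast
  ultimately have "Poly_Mapping.keys r \<subseteq> carrier S \<times> carrier P" "Poly_Mapping.keys z \<subseteq> carrier S \<times> carrier P"
    by (auto simp: free_Abelian_group_def)
  then show ?thesis
    using Poly_Mapping.keys_add[of r z] \<open>c = r + z\<close> by blast
qed

text \<open>
  The map induced from the tensor product is onto, and all its values are combinations of elements
  \<open>\<phi>\<^sub>i(x) = 0\<close>.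
\<close>

lemma torsion_object_UNIV_zero:
  fixes M :: "('k::field, 'm::finite, 'a) Lobj"
  assumes M: "torsion_object M"
  shows "carrier (val M UNIV) = {\<zero>\<^bsub>val M UNIV\<^esub>}"
proof -
  have L: "L_object M" using M by (simp add: torsion_object_def)
  fix i :: 'm
  have notK: "- {i} \<notin> K" "(UNIV :: 'm set) \<notin> K" by (auto simp: not_in_K_iff)
  let ?N = "val M UNIV" and ?P = "val M (- {i})"
  interpret N: graded_Loc_module UNIV ?N
    using L notK by unfold_locales (simp add: L_object_def)
  interpret P: graded_Loc_module "- {i}" ?P
    using L notK by unfold_locales (simp add: L_object_def)
  have "y = \<zero>\<^bsub>?N\<^esub>" if y: "y \<in> carrier ?N" for y
  proof -
    have "tensor_induced ?N (str M i) \<in> gmod_iso (Loc UNIV) (tensor (Loc UNIV) (Loc (- {i})) ?P) ?N"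
      using L by (simp add: L_object_def)
    then obtain g where g: "g \<in> gmod_hom (Loc UNIV) ?N (tensor (Loc UNIV) (Loc (- {i})) ?P)"
      "\<forall>y\<in>carrier ?N. tensor_induced ?N (str M i) (g y) = y"
      unfolding gmod_iso_def by blast
    define X where "X = g y"
    have X: "X \<in> carrier (tensor (Loc UNIV) (Loc (- {i})) ?P)"
      using g(1) y unfolding X_def gmod_hom_def by blast
    have y_eq: "y = tensor_induced ?N (str M i) X"
      using g(2) y unfolding X_def by simp
    have zero: "(\<Oplus>\<^bsub>?N\<^esub>p\<in>Poly_Mapping.keys c. [Poly_Mapping.lookup c p] \<cdot>\<^bsub>?N\<^esub> (fst p \<odot>\<^bsub>?N\<^esub> str M i (snd p)))
        = \<zero>\<^bsub>?N\<^esub>" if "c \<in> X" for c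
    proof (rule N.M.add.finprod_one_eqI)
      fix p assume "p \<in> Poly_Mapping.keys c"
      moreover have "Poly_Mapping.keys c \<subseteq> carrier (Loc UNIV) \<times> carrier ?P"
        by (rule tensor_coset_keys[OF cring_Loc P.module_axioms _ X that])
          (simp add: Loc_def degrees_def)
      ultimately have "fst p \<in> carrier (Loc UNIV)" "str M i (snd p) = \<zero>\<^bsub>?N\<^esub>"
        using torsion_structure_map_zero[OF M, of "snd p" i] by auto
      then show "[Poly_Mapping.lookup c p] \<cdot>\<^bsub>?N\<^esub> (fst p \<odot>\<^bsub>?N\<^esub> str M i (snd p)) = \<zero>\<^bsub>?N\<^esub>"
        by simp
    qed
    moreover obtain c where "c \<in> X" using tensor_coset_nonempty[OF X] by blast
    ultimately have "(\<lambda>c. \<Oplus>\<^bsub>?N\<^esub>p\<in>Poly_Mapping.keys c.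
        [Poly_Mapping.lookup c p] \<cdot>\<^bsub>?N\<^esub> (fst p \<odot>\<^bsub>?N\<^esub> str M i (snd p))) ` X = {\<zero>\<^bsub>?N\<^esub>}"
      by (intro trans[OF image_cong[OF refl zero] image_constant])
    then have "tensor_induced ?N (str M i) X = \<zero>\<^bsub>?N\<^esub>"
      by (simp only: tensor_induced_def the_elem_eq)
    with y_eq show "y = \<zero>\<^bsub>?N\<^esub>" by (rule trans)
  qed
  then show ?thesis using N.M.zero_closed by blast
qed

text \<open>
  With vanishing values at \<open>[m]\<close> the compatibility with the structure maps is automatic, so
  isomorphisms can be chosen separately at each facet.
\<close>

lemma L_isomorphic_if_pointwise_iso:
  fixes M :: "('k::field, 'm::finite, 'a) Lobj" and N :: "('k, 'm, 'b) Lobj"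
  assumes iso: "\<And>\<sigma>. \<sigma> \<notin> K \<Longrightarrow> \<exists>f. f \<in> gmod_iso (Loc \<sigma>) (val M \<sigma>) (val N \<sigma>)"
    and M: "\<And>i x. x \<in> carrier (val M (- {i})) \<Longrightarrow> str M i x \<in> carrier (val M UNIV)"
    and N: "\<And>i x. x \<in> carrier (val N (- {i})) \<Longrightarrow> str N i x \<in> carrier (val N UNIV)"
    and M0: "carrier (val M UNIV) = {z}" and N0: "carrier (val N UNIV) = {w}"
  shows "L_isomorphic M N"
proof -
  from iso have "\<forall>\<sigma>. \<exists>f. \<sigma> \<notin> K \<longrightarrow> f \<in> gmod_iso (Loc \<sigma>) (val M \<sigma>) (val N \<sigma>)" by blast
  then obtain f where f: "\<And>\<sigma>. \<sigma> \<notin> K \<Longrightarrow> f \<sigma> \<in> gmod_iso (Loc \<sigma>) (val M \<sigma>) (val N \<sigma>)"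
    by metis
  then have "\<forall>\<sigma>. \<exists>g. \<sigma> \<notin> K \<longrightarrow> g \<in> gmod_hom (Loc \<sigma>) (val N \<sigma>) (val M \<sigma>) \<and>
      (\<forall>x\<in>carrier (val M \<sigma>). g (f \<sigma> x) = x) \<and> (\<forall>y\<in>carrier (val N \<sigma>). f \<sigma> (g y) = y)"
    by (fastforce simp: gmod_iso_def)
  then obtain g where g: "\<And>\<sigma>. \<sigma> \<notin> K \<Longrightarrow> g \<sigma> \<in> gmod_hom (Loc \<sigma>) (val N \<sigma>) (val M \<sigma>) \<and>
      (\<forall>x\<in>carrier (val M \<sigma>). g \<sigma> (f \<sigma> x) = x) \<and> (\<forall>y\<in>carrier (val N \<sigma>). f \<sigma> (g \<sigma> y) = y)"
    by metis
  have f_hom: "f \<sigma> \<in> gmod_hom (Loc \<sigma>) (val M \<sigma>) (val N \<sigma>)" if "\<sigma> \<notin> K" for \<sigma>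
    using f[OF that] by (simp add: gmod_iso_def)
  have notK: "- {i} \<notin> K" "(UNIV :: 'm set) \<notin> K" for i :: 'm by (auto simp: not_in_K_iff)
  have fc: "f \<sigma> x \<in> carrier (val N \<sigma>)" if "\<sigma> \<notin> K" "x \<in> carrier (val M \<sigma>)" for \<sigma> x
    using f_hom[OF that(1)] that(2) by (auto simp: gmod_hom_def)
  have gc: "g \<sigma> x \<in> carrier (val M \<sigma>)" if "\<sigma> \<notin> K" "x \<in> carrier (val N \<sigma>)" for \<sigma> x
    using g[OF that(1)] that(2) by (auto simp: gmod_hom_def)
  have "f UNIV (str M i x) = str N i (f (- {i}) x)" if "x \<in> carrier (val M (- {i}))" for i x
    using fc[OF notK(2) M[OF that]] N[OF fc[OF notK(1) that]] by (simp add: N0)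
  then have "f \<in> L_hom M N" using f_hom by (simp add: L_hom_def)
  moreover have "g UNIV (str N i x) = str M i (g (- {i}) x)" if "x \<in> carrier (val N (- {i}))" for i x
    using gc[OF notK(2) N[OF that]] M[OF gc[OF notK(1) that]] by (simp add: M0)
  then have "g \<in> L_hom N M" using g by (simp add: L_hom_def)
  ultimately show ?thesis
    using g unfolding L_isomorphic_def by blast
qed

theorem proposition6p4:
  fixes M :: "('k::field, 'm::finite, 'a) Lobj"
  assumes "torsion_object M"
  shows "\<exists>(n::nat) (i :: nat \<Rightarrow> 'm) (a :: nat \<Rightarrow> nat) (b :: nat \<Rightarrow> nat).
    (\<forall>s<n. a s < b s) \<and>
    L_isomorphic M (L_sum {..<n} (\<lambda>s. interval (i s) (a s) (b s)))"
proof -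
  have L: "L_object M" using assms by (simp add: torsion_object_def)
  have notK: "- {j} \<notin> K" "(UNIV :: 'm set) \<notin> K" for j :: 'm by (auto simp: not_in_K_iff)
  have facet: "torsion_facet_module j (val M (- {j}))" for j
    using L assms notK(1)[of j] by unfold_locales (simp_all add: L_object_def torsion_object_def)
  have "\<forall>j. \<exists>(I :: ('a \<times> (int ^ 'm)) set) X a l. interval_basis j (val M (- {j})) I X a l"
    using torsion_facet_module.ex_interval_basis[OF facet] L notK by (simp add: L_object_def)
  then obtain I :: "'m \<Rightarrow> ('a \<times> (int ^ 'm)) set" and X a l where
    basis: "\<And>j. interval_basis j (val M (- {j})) (I j) (X j) (a j) (l j)"
    by metis
  have "finite (I j)" for j using basis[of j] by (simp add: interval_basis_def)
  then have "finite (Sigma UNIV I)" by (intro finite_SigmaI) auto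
  \<comment> \<open>The basis elements of all facets in one list: \<open>h s\<close> is the facet and the index of the \<open>s\<close>-th one.\<close>
  then obtain h where h: "bij_betw h {..<card (Sigma UNIV I)} (Sigma UNIV I)"
    using ex_bij_betw_nat_finite by (auto simp: lessThan_atLeast0)
  define n where "n = card (Sigma UNIV I)"
  define i where "i s = fst (h s)" for s
  define a' where "a' s = a (i s) (snd (h s))" for s
  define b where "b s = a' s + l (i s) (snd (h s))" for s
  let ?N = "L_sum {..<n} (\<lambda>s. interval (i s) (a' s) (b s)) :: ('k, 'm, _) Lobj"
  have bij_j: "bij_betw (snd \<circ> h) {s. s < n \<and> i s = j} (I j)" for j
  proof -
    have "inj_on (snd \<circ> h) {s. s < n \<and> i s = j}"
      using h by (auto simp: inj_on_def bij_betw_def n_def i_def prod_eq_iff)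
    moreover have "(snd \<circ> h) ` {s. s < n \<and> i s = j} = I j"
    proof (intro equalityI subsetI)
      fix t assume "t \<in> I j"
      then have "(j, t) \<in> h ` {..<n}" using h by (simp add: bij_betw_def n_def)
      then obtain s where "s < n" "h s = (j, t)" by auto
      then show "t \<in> (snd \<circ> h) ` {s. s < n \<and> i s = j}"
        by (intro image_eqI[where x = s]) (simp_all add: i_def)
    next
      fix t assume "t \<in> (snd \<circ> h) ` {s. s < n \<and> i s = j}"
      then obtain s where s: "s < n" "i s = j" "t = snd (h s)" by auto
      then have "h s \<in> Sigma UNIV I" using h by (auto simp: bij_betw_def n_def)
      then show "t \<in> I j" using s by (auto simp: i_def)
    qed
    ultimately show ?thesis by (simp add: bij_betw_def)
  qed
  have iso: "\<exists>f. f \<in> gmod_iso (Loc (- {j})) (val M (- {j})) (val ?N (- {j}))" for j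
  proof -
    interpret P: torsion_facet_module j "val M (- {j})" by (rule facet)
    let ?J = "{s. s < n \<and> i s = j}"
    have "interval_basis j (val M (- {j})) ?J (X j \<circ> (snd \<circ> h)) (a j \<circ> (snd \<circ> h)) (l j \<circ> (snd \<circ> h))"
      by (rule P.interval_basis_reindex[OF basis bij_j refl])
    then have "interval_basis j (val M (- {j})) ?J (X j \<circ> (snd \<circ> h)) a' (l j \<circ> (snd \<circ> h))"
      by (simp add: interval_basis_def a'_def)
    then show ?thesis
      by (rule P.sum_of_intervals_iso) (simp add: b_def)
  qed
  have N_UNIV: "val ?N UNIV = gmod_sum {..<n} (\<lambda>s. gmod_zero {0})"
  proof -
    have "UNIV \<noteq> - {j}" for j :: 'm by blast
    then show ?thesis by (simp add: L_sum_def interval_other)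
  qed
  have N0: "carrier (val ?N UNIV) = {\<lambda>s\<in>{..<n}. {0}}"
    unfolding N_UNIV by (auto simp: gmod_sum_def gmod_zero_def PiE_singleton)
  have M0: "carrier (val M UNIV) = {\<zero>\<^bsub>val M UNIV\<^esub>}"
    by (rule torsion_object_UNIV_zero[OF assms])
  have iso_UNIV: "\<exists>f. f \<in> gmod_iso (Loc UNIV) (val M UNIV) (val ?N UNIV)"
  proof -
    interpret graded_Loc_module UNIV "val M UNIV"
      using L notK by unfold_locales (simp add: L_object_def)
    let ?z = "\<lambda>s\<in>{..<n}. {0 :: ('k, 'm) laurent}"
    have "(\<lambda>_. ?z) \<in> gmod_iso (Loc UNIV) (val M UNIV) (val ?N UNIV)"
    proof (rule gmod_iso_if_bij)
      show "(\<lambda>_. ?z) \<in> gmod_hom (Loc UNIV) (val M UNIV) (val ?N UNIV)"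
        unfolding N_UNIV by (auto simp: gmod_hom_def gmod_sum_def gmod_zero_def fun_eq_iff)
      show "bij_betw (\<lambda>_. ?z) (carrier (val M UNIV)) (carrier (val ?N UNIV))"
        unfolding M0 N0 by (simp add: bij_betw_def)
      show "grd (val ?N UNIV) d \<subseteq> (\<lambda>_. ?z) ` grd (val M UNIV) d" for d
        unfolding N_UNIV image_constant[OF grd_zero]
        by (auto simp: gmod_sum_def gmod_zero_def PiE_singleton)
    qed
    then show ?thesis by blast
  qed
  have "L_isomorphic M ?N"
  proof (rule L_isomorphic_if_pointwise_iso[OF _ _ _ M0 N0])
    show "\<exists>f. f \<in> gmod_iso (Loc \<sigma>) (val M \<sigma>) (val ?N \<sigma>)" if "\<sigma> \<notin> K" for \<sigma>
      using that iso iso_UNIV unfolding not_in_K_iff by auto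
    show "str M j x \<in> carrier (val M UNIV)" if "x \<in> carrier (val M (- {j}))" for j x
      using L that by (auto simp: L_object_def gmod_hom_def)
    show "str ?N j x \<in> carrier (val ?N UNIV)" for j x
      unfolding N0 by (simp add: L_sum_def interval_def)
  qed
  moreover have "a' s < b s" if "s < n" for s
  proof -
    have "snd (h s) \<in> I (i s)"
      using bij_j[of "i s"] that by (auto simp: bij_betw_def)
    then show ?thesis using basis[of "i s"] by (simp add: b_def interval_basis_def)
  qed
  ultimately show ?thesis by blast
qed

end
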